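(* Let $d\ge 1$ and let $0<r<1$ be a constant. There exists $\varepsilon>0$ such that the following holds for every constant $\overline{\rho}_1$ with $0<\overline{\rho}_1\le\varepsilon$ and every function $\overline{\rho}_2:\mathbb{Z}^d\to\mathbb{R}$ with $\overline{\rho}_2(0)=0$ and $$\sum_{x\ne 0}|\overline{\rho}_2(x)-\overline{\rho}_1^2|\le r\,\overline{\rho}_1^2 .$$ There exist a pair potential $\Phi$ on $\mathbb{Z}^d$, such that $g(x)=e^{-\Phi(x)}-1$ satisfies (i) $g(x)\ge -a>-1$ for all $x\ne0$, for some constant $a<1$, and (ii) $g(0)=-1$, $g(x)=g(-x)$ for all $x$, and $\sum_{x\neq 0}|g(x)|\le c<\infty$ for some constant $c$, and a value of the activity $z>0$, such that $\overline{\rho}_1$ and $\overline{\rho}_2$ are the first and the second (infinite volume) correlation functions of the system defined by $(z,\Phi)$; that is, the infinite volume correlation functions $\rho_1,\rho_2$ of $(z,\Phi)$ exist and $\rho_1(x_1)=\overline{\rho}_1$, $\rho_2(x_1,x_2)=\overline{\rho}_2(x_2-x_1)$ for all $x_1,x_2\in\mathbb{Z}^d$.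
   Context: A pair potential is a function $\Phi:\mathbb{Z}^d\to(-\infty,+\infty]$ with $\Phi(x)=\Phi(-x)\ge c_0>-\infty$ and $\Phi(0)=+\infty$ (with $e^{-\infty}=0$). The energy of a configuration is $U(x_1,\dots,x_n)=\sum_{1\le i<j\le n}\Phi(x_i-x_j)$. For a finite set $\Lambda\subset\mathbb{Z}^d$ and an activity $z>0$, the grand partition function is $$\Xi(\Lambda,z,\Phi)=\sum_{n=0}^\infty\frac{z^n}{n!}\sum_{(x_1,\dots,x_n)\in\Lambda^n}e^{-U(x_1,\dots,x_n)},$$ and the $m$-point correlation function in $\Lambda$ is, for $x_1,\dots,x_m\in\Lambda$, $$\rho^\Lambda_m(x_1,\dots,x_m)=\Xi(\Lambda,z,\Phi)^{-1}\sum_{n=0}^\infty\frac{z^{m+n}}{n!}\sum_{(y_1,\dots,y_n)\in\Lambda^n}e^{-U(x_1,\dots,x_m,y_1,\dots,y_n)} .$$ The infinite volume correlation functions of the system defined by $(z,\Phi)$ are the limits $\rho_m(x_1,\dots,x_m)=\lim_{k\to\infty}\rho_m^{\Lambda_k}(x_1,\dots,x_m)$ with $\Lambda_k=[-k,k]^d\cap\mathbb{Z}^d$, when these exist. (It is known that under (i)–(ii) they exist and are translation invariant for all $0<z\le\overline{z}(a,c)$, for some $\overline{z}(a,c)>0$.)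
   Formalization: The function ρ̄₂ is additionally assumed even, ρ̄₂(−x)=ρ̄₂(x); this is necessary, since ρ₂(x₁,x₂)=ρ₂(x₂,x₁) always holds, and the claim fails for non-even ρ̄₂ (e.g. ρ̄₁² off 0 perturbed at a single point). *)

theory Defs
  imports "HOL-Analysis.Analysis"
begin

(* Configurations (x_1, ..., x_n) of particles on the lattice are lists, so that the joint
   configuration (x_1, ..., x_m, y_1, ..., y_n) is xs @ ys. *)

definition pair_potential :: "(int ^ 'd \<Rightarrow> ereal) \<Rightarrow> bool" where
  "pair_potential \<Phi> \<longleftrightarrow>
     (\<forall>x. \<Phi> (- x) = \<Phi> x) \<and> (\<exists>c0::real. \<forall>x. ereal c0 \<le> \<Phi> x) \<and> \<Phi> 0 = \<infinity>"

(* exp (- u) for u in (-\<infinity>, \<infinity>]; the value at u = -\<infinity> is junk and is never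
   reached for a pair potential. *)
definition exp_minus :: "ereal \<Rightarrow> real" where
  "exp_minus u = (if u = \<infinity> then 0 else exp (- real_of_ereal u))"

definition energy :: "(int ^ 'd \<Rightarrow> ereal) \<Rightarrow> (int ^ 'd) list \<Rightarrow> ereal" where
  "energy \<Phi> xs = (\<Sum>(i, j) \<in> {(i, j). i < j \<and> j < length xs}. \<Phi> (xs ! i - xs ! j))"

definition configs :: "(int ^ 'd) set \<Rightarrow> nat \<Rightarrow> (int ^ 'd) list set" where
  "configs \<Lambda> n = {xs. length xs = n \<and> set xs \<subseteq> \<Lambda>}"

(* For finite \<Lambda> and \<Phi> 0 = \<infinity> the series in this and the next definition have only
   finitely many nonzero terms, since a configuration with a repeated point has weight 0. *)
definition partition_function ::
    "(int ^ 'd) set \<Rightarrow> real \<Rightarrow> (int ^ 'd \<Rightarrow> ereal) \<Rightarrow> real" where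
  "partition_function \<Lambda> z \<Phi> =
     (\<Sum>n. z ^ n / fact n * (\<Sum>xs \<in> configs \<Lambda> n. exp_minus (energy \<Phi> xs)))"

definition correlation ::
    "(int ^ 'd) set \<Rightarrow> real \<Rightarrow> (int ^ 'd \<Rightarrow> ereal) \<Rightarrow> (int ^ 'd) list \<Rightarrow> real" where
  "correlation \<Lambda> z \<Phi> xs =
     inverse (partition_function \<Lambda> z \<Phi>) *
     (\<Sum>n. z ^ (length xs + n) / fact n *
        (\<Sum>ys \<in> configs \<Lambda> n. exp_minus (energy \<Phi> (xs @ ys))))"

definition lattice_box :: "nat \<Rightarrow> (int ^ 'd) set" where
  "lattice_box k = {x. \<forall>i. \<bar>x $ i\<bar> \<le> int k}"

(* The infinite volume m-point correlation function exists at xs = (x_1, ..., x_m) and has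
   the value l there.  The points of xs lie in lattice_box k for all large k. *)
definition has_inf_vol_correlation ::
    "real \<Rightarrow> (int ^ 'd \<Rightarrow> ereal) \<Rightarrow> (int ^ 'd) list \<Rightarrow> real \<Rightarrow> bool" where
  "has_inf_vol_correlation z \<Phi> xs l \<longleftrightarrow> (\<lambda>k. correlation (lattice_box k) z \<Phi> xs) \<longlonglongrightarrow> l"

definition mayer :: "(int ^ 'd \<Rightarrow> ereal) \<Rightarrow> int ^ 'd \<Rightarrow> real" where
  "mayer \<Phi> x = exp_minus (\<Phi> x) - 1"

end

(* The target is the contraction principle for the Kirkwood-Salsburg hierarchy in which the Mayer
   function g and the activity are unknowns together with the correlations.  Besides the
   normalised correlations sigma None S = rho(S) / rho1^|S|, the correlations sigma (Some y) S of
   the system conditioned on a particle at y (activity multiplied by 1 + g(. - y)) are carried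
   along; a bound on the sum over y of |sigma (Some y) S - sigma None S| then plays the role of
   the cluster property and yields that
     1 + g(x) = rho2(x) / rho1^2 * Q(None) / Q(Some x),
   where Q is the Kirkwood-Salsburg sum at the origin, is an l^1-small perturbation of
   g = rho2 / rho1^2 - 1.  Lipschitz bounds come for free: for a pair (u, v) the norm
   max(|u|, |v|) + L * |u - v| is submultiplicative, so a bound for the image of a pair in this
   norm bounds the difference of the images by 1/L.  At the fixed point, the finite-volume
   correlations satisfy the same equations up to boundary terms and hence converge to sigma. *)

theory Submission
  imports Defs "HOL-Combinatorics.Multiset_Permutations" "HOL-Real_Asymp.Real_Asymp"
begin

section \<open>The submultiplicative norm on pairs\<close>

text \<open>The obstacle is that \<open>g\<close> depends on the quotient Q(None) / Q(Some x), so it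
  stays in l^1 only if Q(Some x) - Q(None) is summable in x, which no supremum bound on correlations
  provides. The equations of the conditioned and the unconditioned system differ by the factor 1 +
  g(x - y), whose deviation from 1 is summable in y; hence a bound on the summed difference
  reproduces itself. The relation between the two families of correlations is not imposed on the
  unknowns; it enters in finite volume only. The activity is eliminated: the normalisation sigma
  None {x} = 1 forces z / rho1 = 1 / Q(None), and this reciprocal stands in the equations. The
  correlation equations contract because each removed particle frees one power of \<xi>. The density
  is needed small only for the sum over nonempty clusters, at most exp (3 \<xi> rho1) - 1.
  Constants: 3 bounds the l^1 norm of \<open>g\<close>, including |g(0)| = 1 and the difference term
  of the pair norm; exp 6 is exp 3 for the product of Mayer factors times exp 3 for the conditioning
  factor; 64 is 8 for the remaining factors times 8 for the gain.\<close>

definition pair_norm :: "real \<Rightarrow> (bool \<Rightarrow> real) \<Rightarrow> real" where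
  "pair_norm L u = max \<bar>u True\<bar> \<bar>u False\<bar> + L * \<bar>u True - u False\<bar>"

lemma pair_norm_nonneg: "0 \<le> L \<Longrightarrow> 0 \<le> pair_norm L u"
  unfolding pair_norm_def by (intro add_nonneg_nonneg mult_nonneg_nonneg) auto

lemma pair_norm_const [simp]: "pair_norm L (\<lambda>_. c) = \<bar>c\<bar>"
  by (simp add: pair_norm_def)

lemma abs_le_pair_norm: "0 \<le> L \<Longrightarrow> \<bar>u b\<bar> \<le> pair_norm L u"
proof -
  assume "0 \<le> L"
  then have "0 \<le> L * \<bar>u True - u False\<bar>" by simp
  moreover have "\<bar>u b\<bar> \<le> max \<bar>u True\<bar> \<bar>u False\<bar>" by (cases b) auto
  ultimately show ?thesis unfolding pair_norm_def by linarith
qed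

lemma diff_le_pair_norm: "L * \<bar>u True - u False\<bar> \<le> pair_norm L u"
  unfolding pair_norm_def by auto

lemma pair_norm_add:
  assumes "0 \<le> L"
  shows "pair_norm L (\<lambda>b. u b + v b) \<le> pair_norm L u + pair_norm L v"
proof -
  have "L * \<bar>(u True + v True) - (u False + v False)\<bar>
      \<le> L * (\<bar>u True - u False\<bar> + \<bar>v True - v False\<bar>)"
    using assms by (intro mult_left_mono) auto
  moreover have "max \<bar>u True + v True\<bar> \<bar>u False + v False\<bar>
      \<le> max \<bar>u True\<bar> \<bar>u False\<bar> + max \<bar>v True\<bar> \<bar>v False\<bar>"
    by linarith
  ultimately show ?thesis unfolding pair_norm_def distrib_left by linarith
qed

lemma pair_norm_minus: "pair_norm L (\<lambda>b. - u b) = pair_norm L u"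
  unfolding pair_norm_def by (simp add: abs_minus_commute)

lemma pair_norm_diff:
  assumes "0 \<le> L"
  shows "pair_norm L (\<lambda>b. u b - v b) \<le> pair_norm L u + pair_norm L v"
  using pair_norm_add[OF assms, of u "\<lambda>b. - v b"] by (simp add: pair_norm_minus)

text \<open>This is the Leibniz rule: for L > 0 the norm is the supremum plus the Lipschitz constant
  of a function on two points at distance 1/L. The product of the norms exceeds what is needed by
  the mixed term (L du)(L dv).\<close>

lemma pair_norm_mult:
  assumes "0 \<le> L"
  shows "pair_norm L (\<lambda>b. u b * v b) \<le> pair_norm L u * pair_norm L v"
proof -
  define mu where "mu = max \<bar>u True\<bar> \<bar>u False\<bar>"
  define mv where "mv = max \<bar>v True\<bar> \<bar>v False\<bar>"
  define du where "du = \<bar>u True - u False\<bar>"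
  define dv where "dv = \<bar>v True - v False\<bar>"
  have nn: "0 \<le> mu" "0 \<le> mv" "0 \<le> du" "0 \<le> dv"
    unfolding mu_def mv_def du_def dv_def by auto
  have le: "\<bar>u b\<bar> \<le> mu" "\<bar>v b\<bar> \<le> mv" for b
    unfolding mu_def mv_def by (cases b; simp)+
  have 1: "max \<bar>u True * v True\<bar> \<bar>u False * v False\<bar> \<le> mu * mv"
    using le nn by (auto simp: abs_mult intro!: mult_mono)
  have "\<bar>u True * v True - u False * v False\<bar>
      = \<bar>u True * (v True - v False) + (u True - u False) * v False\<bar>"
    by (simp add: algebra_simps)
  also have "\<dots> \<le> \<bar>u True\<bar> * dv + du * \<bar>v False\<bar>"
    unfolding du_def dv_def by (rule order_trans[OF abs_triangle_ineq]) (simp add: abs_mult)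
  also have "\<dots> \<le> mu * dv + du * mv"
    using le nn by (intro add_mono mult_mono) auto
  finally have 2: "L * \<bar>u True * v True - u False * v False\<bar> \<le> L * (mu * dv + du * mv)"
    using assms by (rule mult_left_mono)
  have 3: "0 \<le> (L * du) * (L * dv)" using assms nn by simp
  have "(mu + L * du) * (mv + L * dv) = mu * mv + L * (mu * dv + du * mv) + (L * du) * (L * dv)"
    by (simp add: algebra_simps)
  with 1 2 3 have "pair_norm L (\<lambda>b. u b * v b) \<le> (mu + L * du) * (mv + L * dv)"
    unfolding pair_norm_def by linarith
  then show ?thesis unfolding pair_norm_def mu_def mv_def du_def dv_def .
qed

lemma pair_norm_sum:
  assumes "0 \<le> L"
  shows "pair_norm L (\<lambda>b. \<Sum>x\<in>A. u b x) \<le> (\<Sum>x\<in>A. pair_norm L (\<lambda>b. u b x))"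
proof (induction A rule: infinite_finite_induct)
  case (insert x A)
  then show ?case
    using pair_norm_add[OF assms, of "\<lambda>b. u b x" "\<lambda>b. \<Sum>x\<in>A. u b x"] by simp
qed auto

lemma pair_norm_prod:
  assumes "0 \<le> L"
  shows "pair_norm L (\<lambda>b. \<Prod>x\<in>A. u b x) \<le> (\<Prod>x\<in>A. pair_norm L (\<lambda>b. u b x))"
proof (induction A rule: infinite_finite_induct)
  case (insert x A)
  have "pair_norm L (\<lambda>b. \<Prod>x\<in>insert x A. u b x)
      \<le> pair_norm L (\<lambda>b. u b x) * pair_norm L (\<lambda>b. \<Prod>x\<in>A. u b x)"
    using pair_norm_mult[OF assms, of "\<lambda>b. u b x" "\<lambda>b. \<Prod>x\<in>A. u b x"] insert by simp
  also have "\<dots> \<le> pair_norm L (\<lambda>b. u b x) * (\<Prod>x\<in>A. pair_norm L (\<lambda>b. u b x))"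
    by (intro mult_left_mono insert pair_norm_nonneg assms)
  finally show ?case using insert by simp
qed auto

lemma pair_norm_one_plus:
  assumes "0 \<le> L"
  shows "pair_norm L (\<lambda>b. 1 + u b) \<le> 1 + pair_norm L u"
  using pair_norm_add[OF assms, of "\<lambda>b. 1" u] by simp

text \<open>In place of a Neumann series, 1/v = 1 - (v - 1)(1/v) gives N \<le> 1 + e N for the norm
  N of the inverse, and this is solved for N.\<close>

lemma pair_norm_inverse:
  assumes "0 \<le> L" "pair_norm L (\<lambda>b. v b - 1) \<le> e" "e < 1"
  shows "pair_norm L (\<lambda>b. 1 / v b) \<le> 1 / (1 - e)" and "v b > 0"
proof -
  have pos: "v b > 0" for b
    using abs_le_pair_norm[OF assms(1), of "\<lambda>b. v b - 1" b] assms(2,3) by auto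
  show "v b > 0" by (rule pos)
  have "1 / v b = 1 - (v b - 1) * (1 / v b)" for b
    using pos[of b] by (simp add: field_simps)
  then have "pair_norm L (\<lambda>b. 1 / v b) = pair_norm L (\<lambda>b. 1 - (v b - 1) * (1 / v b))"
    by presburger
  also have "\<dots> \<le> pair_norm L (\<lambda>b. 1) + pair_norm L (\<lambda>b. (v b - 1) * (1 / v b))"
    by (rule pair_norm_diff[OF assms(1)])
  also have "\<dots> \<le> 1 + pair_norm L (\<lambda>b. v b - 1) * pair_norm L (\<lambda>b. 1 / v b)"
    using pair_norm_mult[OF assms(1), of "\<lambda>b. v b - 1" "\<lambda>b. 1 / v b"] by simp
  also have "\<dots> \<le> 1 + e * pair_norm L (\<lambda>b. 1 / v b)"
    using assms by (intro add_left_mono mult_right_mono pair_norm_nonneg) auto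
  finally show "pair_norm L (\<lambda>b. 1 / v b) \<le> 1 / (1 - e)"
    using assms(3) by (simp add: field_simps)
qed

section \<open>Sums over finite clusters of product weights\<close>

lemma prod_one_plus_le_exp:
  fixes q :: "'a \<Rightarrow> real"
  assumes "\<And>x. x \<in> A \<Longrightarrow> 0 \<le> q x"
  shows "(\<Prod>x\<in>A. 1 + q x) \<le> exp (\<Sum>x\<in>A. q x)"
proof (cases "finite A")
  case True
  have "(\<Prod>x\<in>A. 1 + q x) \<le> (\<Prod>x\<in>A. exp (q x))"
    using assms by (intro prod_mono) (auto simp: exp_ge_add_one_self add_nonneg_nonneg)
  then show ?thesis by (simp add: exp_sum[OF True])
qed auto

lemma sum_Pow_prod:
  fixes f :: "'a \<Rightarrow> real"
  assumes "finite A"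
  shows "(\<Sum>T\<in>Pow A. \<Prod>x\<in>T. f x) = (\<Prod>x\<in>A. 1 + f x)"
  using prod_add[OF assms, of f "\<lambda>_. 1"] by (simp add: add.commute)

context
  fixes q :: "'a \<Rightarrow> real" and \<theta> :: real
  assumes q_nonneg: "\<And>x. 0 \<le> q x"
    and q_sum: "\<And>F. finite F \<Longrightarrow> (\<Sum>x\<in>F. q x) \<le> \<theta>"
begin

text \<open>Enlarging the family to all subsets of its union makes the sum factorise into the
  product of 1 + q x. The bound is the same for every family, which is what gives summability over
  all finite clusters.\<close>

lemma finite_sum_set_prod_le_exp:
  assumes "finite \<F>" "\<F> \<subseteq> {T. finite T}"
  shows "(\<Sum>T\<in>\<F>. \<Prod>x\<in>T. q x) \<le> exp \<theta>"
proof -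
  have fin: "finite (\<Union>\<F>)" using assms by auto
  have "(\<Sum>T\<in>\<F>. \<Prod>x\<in>T. q x) \<le> (\<Sum>T\<in>Pow (\<Union>\<F>). \<Prod>x\<in>T. q x)"
    using fin by (intro sum_mono2) (auto intro: prod_nonneg q_nonneg)
  also have "\<dots> \<le> exp (\<Sum>x\<in>\<Union>\<F>. q x)"
    using prod_one_plus_le_exp[of "\<Union>\<F>" q] q_nonneg by (simp add: sum_Pow_prod[OF fin])
  also have "\<dots> \<le> exp \<theta>" using q_sum[OF fin] by simp
  finally show ?thesis .
qed

lemma set_prod_summable:
  assumes "P \<subseteq> {T. finite T}"
  shows "(\<lambda>T. \<Prod>x\<in>T. q x) summable_on P"
proof (rule nonneg_bdd_above_summable_on)
  show "bdd_above (sum (\<lambda>T. \<Prod>x\<in>T. q x) ` {F. F \<subseteq> P \<and> finite F})"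
    using finite_sum_set_prod_le_exp assms by (intro bdd_aboveI[of _ "exp \<theta>"]) auto
qed (auto intro: prod_nonneg q_nonneg)

lemma infsum_set_prod_le_exp:
  assumes "P \<subseteq> {T. finite T}"
  shows "(\<Sum>\<^sub>\<infinity>T\<in>P. \<Prod>x\<in>T. q x) \<le> exp \<theta>"
  by (rule infsum_le_finite_sums[OF set_prod_summable[OF assms]])
     (use finite_sum_set_prod_le_exp assms in auto)

lemma infsum_nonempty_set_prod_le_exp:
  assumes "P \<subseteq> {T. finite T}" "{} \<notin> P"
  shows "(\<Sum>\<^sub>\<infinity>T\<in>P. \<Prod>x\<in>T. q x) \<le> exp \<theta> - 1"
proof (rule infsum_le_finite_sums[OF set_prod_summable[OF assms(1)]])
  fix \<F> assume F: "finite \<F>" "\<F> \<subseteq> P"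
  then have "{} \<notin> \<F>" "insert {} \<F> \<subseteq> {T. finite T}" using assms by auto
  then show "(\<Sum>T\<in>\<F>. \<Prod>x\<in>T. q x) \<le> exp \<theta> - 1"
    using finite_sum_set_prod_le_exp[of "insert {} \<F>"] F by simp
qed

end

text \<open>The pair norm is continuous, so the bound passes from finite partial sums to the limit.
  The sum over \<open>y\<close> is carried along because the quantity to be propagated is an l^1
  norm in the conditioning point.\<close>

lemma sum_pair_norm_infsum_le:
  assumes L: "0 \<le> L"
    and u: "\<And>b y. y \<in> F \<Longrightarrow> u b y summable_on P"
    and B: "B summable_on P"
    and le: "\<And>T. T \<in> P \<Longrightarrow> (\<Sum>y\<in>F. pair_norm L (\<lambda>b. u b y T)) \<le> B T"
  shows "(\<Sum>y\<in>F. pair_norm L (\<lambda>b. \<Sum>\<^sub>\<infinity>T\<in>P. u b y T)) \<le> (\<Sum>\<^sub>\<infinity>T\<in>P. B T)"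
proof (rule tendsto_le[OF finite_subsets_at_top_neq_bot])
  show "((\<lambda>G. \<Sum>y\<in>F. pair_norm L (\<lambda>b. \<Sum>T\<in>G. u b y T))
      \<longlongrightarrow> (\<Sum>y\<in>F. pair_norm L (\<lambda>b. \<Sum>\<^sub>\<infinity>T\<in>P. u b y T))) (finite_subsets_at_top P)"
    unfolding pair_norm_def by (intro tendsto_intros infsum_tendsto u)
  show "(sum B \<longlongrightarrow> infsum B P) (finite_subsets_at_top P)"
    by (rule infsum_tendsto[OF B])
  show "\<forall>\<^sub>F G in finite_subsets_at_top P.
      (\<Sum>y\<in>F. pair_norm L (\<lambda>b. \<Sum>T\<in>G. u b y T)) \<le> sum B G"
  proof (rule eventually_finite_subsets_at_top_weakI)
    fix G assume G: "finite G" "G \<subseteq> P"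
    have "(\<Sum>y\<in>F. pair_norm L (\<lambda>b. \<Sum>T\<in>G. u b y T))
        \<le> (\<Sum>y\<in>F. \<Sum>T\<in>G. pair_norm L (\<lambda>b. u b y T))"
      by (intro sum_mono pair_norm_sum L)
    also have "\<dots> = (\<Sum>T\<in>G. \<Sum>y\<in>F. pair_norm L (\<lambda>b. u b y T))" by (rule sum.swap)
    also have "\<dots> \<le> sum B G" using G by (intro sum_mono le) auto
    finally show "(\<Sum>y\<in>F. pair_norm L (\<lambda>b. \<Sum>T\<in>G. u b y T)) \<le> sum B G" .
  qed
qed

text \<open>The common estimate behind all Kirkwood-Salsburg sums: the growth \<xi>^|T| of the
  correlations is absorbed into the one-point factors. \<open>y\<close> is the conditioning point,
  or a dummy from a one-element set when there is none. Leaving out the empty cluster subtracts 1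
  from the exponential, and this is where small factors come from.\<close>

lemma sum_pair_norm_cluster_le:
  fixes a :: "bool \<Rightarrow> 'a \<Rightarrow> real" and s :: "bool \<Rightarrow> 'b \<Rightarrow> 'a set \<Rightarrow> real"
  assumes L: "0 \<le> L" and F: "finite F" and P: "P \<subseteq> {T. finite T}"
    and \<xi>: "0 \<le> \<xi>" and C: "0 \<le> C"
    and a: "\<And>G. finite G \<Longrightarrow> (\<Sum>t\<in>G. pair_norm L (\<lambda>b. a b t)) \<le> \<theta>"
    and s: "\<And>T. T \<in> P \<Longrightarrow> (\<Sum>y\<in>F. pair_norm L (\<lambda>b. s b y T)) \<le> C * \<xi> ^ card T"
  shows "(\<Sum>y\<in>F. pair_norm L (\<lambda>b. \<Sum>\<^sub>\<infinity>T\<in>P. (\<Prod>t\<in>T. a b t) * s b y T)) \<le> C * exp (\<xi> * \<theta>)"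
    and "{} \<notin> P \<Longrightarrow>
      (\<Sum>y\<in>F. pair_norm L (\<lambda>b. \<Sum>\<^sub>\<infinity>T\<in>P. (\<Prod>t\<in>T. a b t) * s b y T)) \<le> C * (exp (\<xi> * \<theta>) - 1)"
    and "y \<in> F \<Longrightarrow> (\<lambda>T. (\<Prod>t\<in>T. a b t) * s b y T) summable_on P"
proof -
  define q where "q t = \<xi> * pair_norm L (\<lambda>b. a b t)" for t
  have q0: "0 \<le> q t" for t unfolding q_def using \<xi> pair_norm_nonneg[OF L] by simp
  have qs: "(\<Sum>t\<in>G. q t) \<le> \<xi> * \<theta>" if "finite G" for G
    unfolding q_def sum_distrib_left[symmetric] using a[OF that] \<xi> by (rule mult_left_mono)
  define B where "B T = C * (\<Prod>t\<in>T. q t)" for T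
  have Bs: "B summable_on P"
    unfolding B_def by (intro summable_on_cmult_right set_prod_summable[OF q0 qs P])
  have le: "(\<Sum>y\<in>F. pair_norm L (\<lambda>b. (\<Prod>t\<in>T. a b t) * s b y T)) \<le> B T" if "T \<in> P" for T
  proof -
    have "(\<Sum>y\<in>F. pair_norm L (\<lambda>b. (\<Prod>t\<in>T. a b t) * s b y T))
        \<le> (\<Sum>y\<in>F. (\<Prod>t\<in>T. pair_norm L (\<lambda>b. a b t)) * pair_norm L (\<lambda>b. s b y T))"
      by (intro sum_mono order_trans[OF pair_norm_mult[OF L]] mult_right_mono
          pair_norm_prod[OF L] pair_norm_nonneg[OF L])
    also have "\<dots> = (\<Prod>t\<in>T. pair_norm L (\<lambda>b. a b t)) * (\<Sum>y\<in>F. pair_norm L (\<lambda>b. s b y T))"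
      by (simp add: sum_distrib_left)
    also have "\<dots> \<le> (\<Prod>t\<in>T. pair_norm L (\<lambda>b. a b t)) * (C * \<xi> ^ card T)"
      by (intro mult_left_mono s that prod_nonneg pair_norm_nonneg[OF L])
    also have "\<dots> = B T" unfolding B_def q_def by (simp add: prod.distrib)
    finally show ?thesis .
  qed
  show summ: "(\<lambda>T. (\<Prod>t\<in>T. a b t) * s b y T) summable_on P" if y: "y \<in> F" for b y
  proof -
    have "norm ((\<Prod>t\<in>T. a b t) * s b y T) \<le> B T" if T: "T \<in> P" for T
    proof -
      have "\<bar>(\<Prod>t\<in>T. a b t) * s b y T\<bar> \<le> pair_norm L (\<lambda>b. (\<Prod>t\<in>T. a b t) * s b y T)"
        using abs_le_pair_norm[OF L, of "\<lambda>b. (\<Prod>t\<in>T. a b t) * s b y T" b] .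
      also have "\<dots> \<le> (\<Sum>y\<in>F. pair_norm L (\<lambda>b. (\<Prod>t\<in>T. a b t) * s b y T))"
        by (intro member_le_sum y F pair_norm_nonneg[OF L])
      also have "\<dots> \<le> B T" by (rule le[OF T])
      finally show ?thesis by simp
    qed
    then have "(\<lambda>T. norm ((\<Prod>t\<in>T. a b t) * s b y T)) summable_on P"
      by (rule Infinite_Sum.abs_summable_on_comparison_test'[OF Bs])
    then show ?thesis by (rule abs_summable_summable)
  qed
  have main: "(\<Sum>y\<in>F. pair_norm L (\<lambda>b. \<Sum>\<^sub>\<infinity>T\<in>P. (\<Prod>t\<in>T. a b t) * s b y T)) \<le> infsum B P"
    by (rule sum_pair_norm_infsum_le[OF L summ Bs le])
  have eq: "infsum B P = C * (\<Sum>\<^sub>\<infinity>T\<in>P. \<Prod>t\<in>T. q t)"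
    unfolding B_def by (rule infsum_cmult_right')
  show "(\<Sum>y\<in>F. pair_norm L (\<lambda>b. \<Sum>\<^sub>\<infinity>T\<in>P. (\<Prod>t\<in>T. a b t) * s b y T)) \<le> C * exp (\<xi> * \<theta>)"
    using main mult_left_mono[OF infsum_set_prod_le_exp[OF q0 qs P] C] unfolding eq by linarith
  show "(\<Sum>y\<in>F. pair_norm L (\<lambda>b. \<Sum>\<^sub>\<infinity>T\<in>P. (\<Prod>t\<in>T. a b t) * s b y T)) \<le> C * (exp (\<xi> * \<theta>) - 1)"
    if "{} \<notin> P"
    using main mult_left_mono[OF infsum_nonempty_set_prod_le_exp[OF q0 qs P that] C]
    unfolding eq by linarith
qed

section \<open>The Kirkwood-Salsburg map\<close>

text \<open>Insertion of a particle at \<open>x\<close>: expands the factor \<open>\<Prod>u. 1 + g (x - u)\<close> over the particles \<open>u\<close>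
  outside \<open>Y\<close>.  Here \<open>s\<close> is normalised by powers of the density \<open>\<rho>\<close>, which is why \<open>\<rho>\<close> enters
  the product.\<close>

definition ks_sum ::
    "real \<Rightarrow> ('v::ab_group_add \<Rightarrow> real) \<Rightarrow> ('v set \<Rightarrow> real) \<Rightarrow> 'v \<Rightarrow> 'v set \<Rightarrow> real" where
  "ks_sum \<rho> g s x Y =
     (\<Sum>\<^sub>\<infinity>T\<in>{T. finite T \<and> T \<inter> Y = {}}. (\<Prod>t\<in>T. \<rho> * g (x - t)) * s (Y \<union> T))"

definition palm_weight :: "('v::ab_group_add \<Rightarrow> real) \<Rightarrow> 'v option \<Rightarrow> 'v \<Rightarrow> real" where
  "palm_weight g i x = (case i of None \<Rightarrow> 1 | Some y \<Rightarrow> 1 + g (x - y))"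

definition ks_rhs ::
    "real \<Rightarrow> ('v::ab_group_add \<Rightarrow> real) \<Rightarrow> ('v option \<Rightarrow> 'v set \<Rightarrow> real) \<Rightarrow>
      'v option \<Rightarrow> 'v \<Rightarrow> 'v set \<Rightarrow> real" where
  "ks_rhs \<rho> g \<sigma> i x Y =
     palm_weight g i x * (\<Prod>y\<in>Y. 1 + g (x - y)) * ks_sum \<rho> g (\<sigma> i) x Y *
       (1 / ks_sum \<rho> g (\<sigma> None) 0 {})"

text \<open>Averaging over the removed particle \<open>x\<close>, rather than choosing one, makes the map commute with
  lattice symmetries.  The value on infinite \<open>S\<close> is irrelevant.\<close>

definition ks_corr ::
    "real \<Rightarrow> ('v::ab_group_add \<Rightarrow> real) \<Rightarrow> ('v option \<Rightarrow> 'v set \<Rightarrow> real) \<Rightarrow>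
      'v option \<Rightarrow> 'v set \<Rightarrow> real" where
  "ks_corr \<rho> g \<sigma> i S =
     (if S = {} then 1 else (\<Sum>x\<in>S. 1 / real (card S) * ks_rhs \<rho> g \<sigma> i x (S - {x})))"

definition ks_mayer ::
    "('v \<Rightarrow> real) \<Rightarrow> real \<Rightarrow> ('v::ab_group_add \<Rightarrow> real) \<Rightarrow> ('v option \<Rightarrow> 'v set \<Rightarrow> real) \<Rightarrow>
      'v \<Rightarrow> real" where
  "ks_mayer h \<rho> g \<sigma> x =
     (1 + h x) * ks_sum \<rho> g (\<sigma> None) 0 {} * (1 / ks_sum \<rho> g (\<sigma> (Some x)) 0 {}) - 1"

section \<open>Estimates for one step of the map in the pair norm\<close>

lemma infsum_diff:
  fixes f g :: "'a \<Rightarrow> real"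
  assumes "f summable_on A" "g summable_on A"
  shows "(\<Sum>\<^sub>\<infinity>x\<in>A. f x - g x) = infsum f A - infsum g A"
  using infsum_add[OF assms(1), of "\<lambda>x. - g x"] assms(2)
  by (simp add: infsum_uminus summable_on_uminus)

text \<open>The two values of the boolean are two states to be compared. \<open>L\<close> will be
  inversely proportional to their distance; with equal states only sizes are measured.
  \<open>corr_palm\<close> is the summed form of the cluster property.\<close>

locale ks_pair =
  fixes L \<xi> \<rho> \<delta> :: real
    and g :: "bool \<Rightarrow> 'v::ab_group_add \<Rightarrow> real"
    and \<sigma> :: "bool \<Rightarrow> 'v option \<Rightarrow> 'v set \<Rightarrow> real"
  assumes L: "0 \<le> L" and \<xi>: "64 * exp 6 \<le> \<xi>" and \<rho>: "0 < \<rho>"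
    and \<delta>: "exp (\<xi> * (3 * \<rho>)) - 1 \<le> \<delta>" "\<delta> \<le> 1 / 2"
    and corr_empty: "\<And>b i. \<sigma> b i {} = 1"
    and corr_bound: "\<And>i S. finite S \<Longrightarrow> pair_norm L (\<lambda>b. \<sigma> b i S) \<le> \<xi> ^ card S"
    and corr_palm: "\<And>F S. finite F \<Longrightarrow> finite S \<Longrightarrow>
      (\<Sum>y\<in>F. pair_norm L (\<lambda>b. \<sigma> b (Some y) S - \<sigma> b None S)) \<le> 3 * \<xi> ^ card S"
    and mayer_sum: "\<And>F. finite F \<Longrightarrow> (\<Sum>x\<in>F. pair_norm L (\<lambda>b. g b x)) \<le> 3"
begin

lemma \<xi>_pos: "0 < \<xi>"
  using \<xi> exp_gt_zero[of "6::real"] by linarith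

lemma exp_le: "exp (\<xi> * (3 * \<rho>)) \<le> 1 + \<delta>"
  using \<delta> by simp

lemma \<delta>_pos: "0 < \<delta>"
proof -
  have "1 < exp (\<xi> * (3 * \<rho>))" using \<xi>_pos \<rho> by simp
  then show ?thesis using \<delta> by linarith
qed

lemma mayer_shift_sum:
  assumes "finite G"
  shows "(\<Sum>t\<in>G. pair_norm L (\<lambda>b. g b (x - t))) \<le> 3"
proof -
  have "(\<Sum>t\<in>G. pair_norm L (\<lambda>b. g b (x - t))) = (\<Sum>y\<in>(\<lambda>t. x - t) ` G. pair_norm L (\<lambda>b. g b y))"
    by (subst sum.reindex) (auto simp: inj_on_def)
  then show ?thesis using mayer_sum[of "(\<lambda>t. x - t) ` G"] assms by simp
qed

lemma mayer_bound: "pair_norm L (\<lambda>b. g b x) \<le> 3"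
  using mayer_sum[of "{x}"] by simp

lemma activity_sum:
  assumes "finite G"
  shows "(\<Sum>t\<in>G. pair_norm L (\<lambda>b. \<rho> * g b (x - t))) \<le> 3 * \<rho>"
proof -
  have "(\<Sum>t\<in>G. pair_norm L (\<lambda>b. \<rho> * g b (x - t))) \<le> (\<Sum>t\<in>G. \<rho> * pair_norm L (\<lambda>b. g b (x - t)))"
    using pair_norm_mult[OF L, of "\<lambda>_. \<rho>"] \<rho> by (intro sum_mono) simp
  also have "\<dots> \<le> \<rho> * 3"
    unfolding sum_distrib_left[symmetric]
    using mayer_shift_sum[OF assms] \<rho> by (intro mult_left_mono) auto
  finally show ?thesis by simp
qed

lemma corr_Un_bound:
  assumes "finite Y" "T \<in> {T. finite T \<and> T \<inter> Y = {}}"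
  shows "pair_norm L (\<lambda>b. \<sigma> b i (Y \<union> T)) \<le> \<xi> ^ card Y * \<xi> ^ card T"
proof -
  have "card (Y \<union> T) = card Y + card T" using assms by (intro card_Un_disjoint) auto
  then show ?thesis using corr_bound[of "Y \<union> T" i] assms by (simp add: power_add)
qed

lemma corr_Un_palm:
  assumes "finite F" "finite Y" "T \<in> {T. finite T \<and> T \<inter> Y = {}}"
  shows "(\<Sum>y\<in>F. pair_norm L (\<lambda>b. \<sigma> b (Some y) (Y \<union> T) - \<sigma> b None (Y \<union> T)))
    \<le> 3 * \<xi> ^ card Y * \<xi> ^ card T"
proof -
  have "card (Y \<union> T) = card Y + card T" using assms by (intro card_Un_disjoint) auto
  then show ?thesis using corr_palm[of F "Y \<union> T"] assms by (simp add: power_add mult.assoc)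
qed

lemma ks_summable:
  assumes "finite Y"
  shows "(\<lambda>T. (\<Prod>t\<in>T. \<rho> * g b (x - t)) * \<sigma> b i (Y \<union> T))
    summable_on {T. finite T \<and> T \<inter> Y = {}}"
  by (rule sum_pair_norm_cluster_le(3)[where F = "{()}" and y = "()" and L = L and \<xi> = \<xi>
        and C = "\<xi> ^ card Y" and \<theta> = "3 * \<rho>" and a = "\<lambda>b t. \<rho> * g b (x - t)"
        and s = "\<lambda>b _ T. \<sigma> b i (Y \<union> T)"])
    (use L \<xi>_pos activity_sum corr_Un_bound[OF assms, of _ i] in auto)

lemma ks_sum_bound:
  assumes "finite Y"
  shows "pair_norm L (\<lambda>b. ks_sum \<rho> (g b) (\<sigma> b i) x Y) \<le> \<xi> ^ card Y * (1 + \<delta>)"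
proof -
  have "(\<Sum>y\<in>{()}. pair_norm L (\<lambda>b. ks_sum \<rho> (g b) (\<sigma> b i) x Y)) \<le> \<xi> ^ card Y * exp (\<xi> * (3 * \<rho>))"
    unfolding ks_sum_def
    by (rule sum_pair_norm_cluster_le(1)[where L = L])
      (use L \<xi>_pos activity_sum corr_Un_bound[OF assms, of _ i] in auto)
  also have "\<dots> \<le> \<xi> ^ card Y * (1 + \<delta>)" using exp_le \<xi>_pos by (intro mult_left_mono) auto
  finally show ?thesis by simp
qed

text \<open>The empty cluster contributes exactly 1. The remainder is small, which makes the
  normalising quotients invertible.\<close>

lemma ks_sum_minus_one:
  "pair_norm L (\<lambda>b. ks_sum \<rho> (g b) (\<sigma> b i) x {} - 1) \<le> \<delta>"
proof -
  let ?P = "{T::'v set. finite T}"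
  have eq: "ks_sum \<rho> (g b) (\<sigma> b i) x {} - 1
      = (\<Sum>\<^sub>\<infinity>T\<in>?P - {{}}. (\<Prod>t\<in>T. \<rho> * g b (x - t)) * \<sigma> b i T)" for b
    using infsum_Diff[OF ks_summable[of "{}" b x i], of "{{}}"] unfolding ks_sum_def
    by (simp add: corr_empty)
  have "(\<Sum>y\<in>{()}. pair_norm L (\<lambda>b. \<Sum>\<^sub>\<infinity>T\<in>?P - {{}}. (\<Prod>t\<in>T. \<rho> * g b (x - t)) * \<sigma> b i T))
      \<le> 1 * (exp (\<xi> * (3 * \<rho>)) - 1)"
    by (rule sum_pair_norm_cluster_le(2)[where L = L])
      (use L \<xi>_pos activity_sum corr_bound[of _ i] in auto)
  then show ?thesis unfolding eq using \<delta> by simp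
qed

lemmas ks_sum_inverse = pair_norm_inverse(1)[OF L ks_sum_minus_one]

lemma ks_sum_inverse_le: "pair_norm L (\<lambda>b. 1 / ks_sum \<rho> (g b) (\<sigma> b i) x {}) \<le> 2"
proof -
  have "pair_norm L (\<lambda>b. 1 / ks_sum \<rho> (g b) (\<sigma> b i) x {}) \<le> 1 / (1 - \<delta>)"
    using \<delta> by (intro ks_sum_inverse) auto
  also have "\<dots> \<le> 2" using \<delta> by (simp add: field_simps)
  finally show ?thesis .
qed

lemma ks_sum_pos: "0 < ks_sum \<rho> (g b) (\<sigma> b i) x {}"
  using pair_norm_inverse(2)[OF L, of "\<lambda>b. ks_sum \<rho> (g b) (\<sigma> b i) x {}" \<delta> b] ks_sum_minus_one[of i x] \<delta>
  by simp

lemma ks_sum_diff: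
  assumes "finite Y"
  shows "ks_sum \<rho> (g b) (\<sigma> b i) x Y - ks_sum \<rho> (g b) (\<sigma> b j) x Y =
    (\<Sum>\<^sub>\<infinity>T\<in>{T. finite T \<and> T \<inter> Y = {}}.
      (\<Prod>t\<in>T. \<rho> * g b (x - t)) * (\<sigma> b i (Y \<union> T) - \<sigma> b j (Y \<union> T)))"
  unfolding ks_sum_def right_diff_distrib
  by (intro infsum_diff[symmetric] ks_summable assms)

lemma ks_sum_palm:
  assumes "finite F" "finite Y"
  shows "(\<Sum>y\<in>F. pair_norm L (\<lambda>b. ks_sum \<rho> (g b) (\<sigma> b (Some y)) x Y - ks_sum \<rho> (g b) (\<sigma> b None) x Y))
    \<le> 3 * \<xi> ^ card Y * (1 + \<delta>)"
proof -
  have "(\<Sum>y\<in>F. pair_norm L (\<lambda>b. ks_sum \<rho> (g b) (\<sigma> b (Some y)) x Y - ks_sum \<rho> (g b) (\<sigma> b None) x Y))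
      \<le> 3 * \<xi> ^ card Y * exp (\<xi> * (3 * \<rho>))"
    unfolding ks_sum_diff[OF assms(2)]
    by (rule sum_pair_norm_cluster_le(1)[where L = L])
      (use L \<xi>_pos activity_sum corr_Un_palm[OF assms] assms(1) in auto)
  also have "\<dots> \<le> 3 * \<xi> ^ card Y * (1 + \<delta>)" using exp_le \<xi>_pos by (intro mult_left_mono) auto
  finally show ?thesis .
qed

text \<open>All systems agree on the empty set, so the empty cluster cancels and the factor 1 +
  \<delta> of \<open>ks_sum_palm\<close> improves to \<delta>. This makes \<open>g\<close> an
  l^1-small perturbation of \<open>h\<close>.\<close>

lemma ks_sum_palm_root:
  assumes "finite F"
  shows "(\<Sum>y\<in>F. pair_norm L (\<lambda>b. ks_sum \<rho> (g b) (\<sigma> b (Some y)) x {} - ks_sum \<rho> (g b) (\<sigma> b None) x {}))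
    \<le> 3 * \<delta>"
proof -
  let ?P = "{T::'v set. finite T}"
  have eq: "(\<Sum>\<^sub>\<infinity>T\<in>?P. (\<Prod>t\<in>T. \<rho> * g b (x - t)) * (\<sigma> b i T - \<sigma> b j T))
      = (\<Sum>\<^sub>\<infinity>T\<in>?P - {{}}. (\<Prod>t\<in>T. \<rho> * g b (x - t)) * (\<sigma> b i T - \<sigma> b j T))" for b i j
    by (rule infsum_cong_neutral) (auto simp: corr_empty)
  have "(\<Sum>y\<in>F. pair_norm L (\<lambda>b. \<Sum>\<^sub>\<infinity>T\<in>?P - {{}}.
          (\<Prod>t\<in>T. \<rho> * g b (x - t)) * (\<sigma> b (Some y) T - \<sigma> b None T)))
      \<le> 3 * (exp (\<xi> * (3 * \<rho>)) - 1)"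
    by (rule sum_pair_norm_cluster_le(2)[where L = L])
      (use L \<xi>_pos activity_sum corr_palm[OF assms] assms in auto)
  then show ?thesis using \<delta> by (simp add: ks_sum_diff eq)
qed

lemma mayer_prod_bound:
  assumes "finite Y"
  shows "pair_norm L (\<lambda>b. \<Prod>y\<in>Y. 1 + g b (x - y)) \<le> exp 3"
proof -
  have "pair_norm L (\<lambda>b. \<Prod>y\<in>Y. 1 + g b (x - y)) \<le> (\<Prod>y\<in>Y. pair_norm L (\<lambda>b. 1 + g b (x - y)))"
    by (rule pair_norm_prod[OF L])
  also have "\<dots> \<le> (\<Prod>y\<in>Y. 1 + pair_norm L (\<lambda>b. g b (x - y)))"
    by (intro prod_mono conjI pair_norm_nonneg pair_norm_one_plus L)
  also have "\<dots> \<le> exp (\<Sum>y\<in>Y. pair_norm L (\<lambda>b. g b (x - y)))"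
    by (rule prod_one_plus_le_exp) (rule pair_norm_nonneg[OF L])
  also have "\<dots> \<le> exp 3" using mayer_shift_sum[OF assms] by simp
  finally show ?thesis .
qed

lemma palm_weight_bound: "pair_norm L (\<lambda>b. palm_weight (g b) i x) \<le> exp 3"
proof -
  have "pair_norm L (\<lambda>b. palm_weight (g b) i x) \<le> 4"
  proof (cases i)
    case (Some y)
    then show ?thesis
      using order_trans[OF pair_norm_one_plus[OF L, of "\<lambda>b. g b (x - y)"]] mayer_bound[of "x - y"]
      by (simp add: palm_weight_def)
  qed (simp add: palm_weight_def)
  also have "4 \<le> exp (3::real)" using exp_ge_add_one_self[of 3] by simp
  finally show ?thesis .
qed

lemma pair_norm_mult_le:
  assumes "pair_norm L u \<le> p" "pair_norm L v \<le> q"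
  shows "pair_norm L (\<lambda>b. u b * v b) \<le> p * q"
  using assms pair_norm_nonneg[OF L]
  by (intro order_trans[OF pair_norm_mult[OF L]] mult_mono) (auto intro: order_trans)

text \<open>The four factors are at most exp 3, exp 3, \<xi>^|Y| (1 + \<delta>) and 2. Apart from
  the power of \<xi> their product is below 8 exp 6 \<le> \<xi> / 8, so the extra power of \<xi> on
  the right pays for the inserted particle with a factor 8 to spare.\<close>

lemma ks_rhs_bound:
  assumes "finite Y"
  shows "pair_norm L (\<lambda>b. ks_rhs \<rho> (g b) (\<sigma> b) i x Y) \<le> \<xi> ^ Suc (card Y) / 8"
proof -
  have "pair_norm L (\<lambda>b. ks_rhs \<rho> (g b) (\<sigma> b) i x Y)
      \<le> exp 3 * exp 3 * (\<xi> ^ card Y * (1 + \<delta>)) * 2"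
    unfolding ks_rhs_def
    by (intro pair_norm_mult_le palm_weight_bound mayer_prod_bound ks_sum_bound
        ks_sum_inverse_le assms)
  also have "\<dots> = \<xi> ^ card Y * (exp 6 * ((1 + \<delta>) * 2))"
    by (simp add: exp_add[symmetric] mult.assoc mult.left_commute)
  also have "\<dots> \<le> \<xi> ^ card Y * (exp 6 * 8)"
    using \<delta> \<xi>_pos by (intro mult_left_mono) auto
  also have "\<dots> \<le> \<xi> ^ card Y * (\<xi> / 8)"
    using \<xi> \<xi>_pos by (intro mult_left_mono) auto
  finally show ?thesis by (simp add: mult.commute)
qed

lemma ks_rhs_palm:
  assumes "finite F" "finite Y"
  shows "(\<Sum>y\<in>F. pair_norm L (\<lambda>b. ks_rhs \<rho> (g b) (\<sigma> b) (Some y) x Y - ks_rhs \<rho> (g b) (\<sigma> b) None x Y))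
    \<le> 3 * \<xi> ^ Suc (card Y) / 8"
proof -
  let ?Q = "\<lambda>b i. ks_sum \<rho> (g b) (\<sigma> b i) x Y"
  let ?A = "\<lambda>b. (\<Prod>y\<in>Y. 1 + g b (x - y)) * (1 / ks_sum \<rho> (g b) (\<sigma> b None) 0 {})"
  \<comment> \<open>The product rule for (1 + g) Q(Some y) - Q(None): the first term is summable in
    \<open>y\<close> because \<open>g\<close> is, the second by the summed bound on the differences
    of the sums.\<close>
  have eq: "ks_rhs \<rho> (g b) (\<sigma> b) (Some y) x Y - ks_rhs \<rho> (g b) (\<sigma> b) None x Y
      = ?A b * (g b (x - y) * ?Q b (Some y) + (?Q b (Some y) - ?Q b None))" for b y
    unfolding ks_rhs_def palm_weight_def by (simp add: algebra_simps)
  have A: "pair_norm L ?A \<le> exp 3 * 2"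
    by (intro pair_norm_mult_le mayer_prod_bound ks_sum_inverse_le assms)
  let ?G = "\<lambda>y. pair_norm L (\<lambda>b. g b (x - y))"
  let ?D = "\<lambda>y. pair_norm L (\<lambda>b. ?Q b (Some y) - ?Q b None)"
  let ?c = "\<xi> ^ card Y * (1 + \<delta>)"
  have c: "0 \<le> ?c" using \<xi>_pos \<delta>_pos by simp
  have "(\<Sum>y\<in>F. pair_norm L (\<lambda>b. ks_rhs \<rho> (g b) (\<sigma> b) (Some y) x Y - ks_rhs \<rho> (g b) (\<sigma> b) None x Y))
      \<le> (\<Sum>y\<in>F. (exp 3 * 2) * (?G y * ?c + ?D y))"
    unfolding eq
    by (intro sum_mono pair_norm_mult_le A order_trans[OF pair_norm_add[OF L]] add_right_mono
        ks_sum_bound assms order_refl)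
  also have "\<dots> = (exp 3 * 2) * ((\<Sum>y\<in>F. ?G y) * ?c + (\<Sum>y\<in>F. ?D y))"
    by (simp only: sum_distrib_right sum.distrib[symmetric] sum_distrib_left)
  also have "\<dots> \<le> (exp 3 * 2) * (3 * ?c + 3 * \<xi> ^ card Y * (1 + \<delta>))"
    using c by (intro mult_left_mono add_mono mult_right_mono mayer_shift_sum ks_sum_palm assms) auto
  also have "\<dots> = 3 * \<xi> ^ card Y * (exp 3 * (4 * (1 + \<delta>)))"
    by (simp add: algebra_simps)
  also have "\<dots> \<le> 3 * \<xi> ^ card Y * (exp 6 * 8)"
    using \<delta> \<xi>_pos \<delta>_pos by (intro mult_left_mono mult_mono) auto
  also have "\<dots> \<le> 3 * \<xi> ^ card Y * (\<xi> / 8)"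
    using \<xi> \<xi>_pos by (intro mult_left_mono) auto
  finally show ?thesis by (simp add: mult_ac)
qed

text \<open>The weights add up to 1, so a bound that is uniform in the removed particle survives
  averaging.\<close>

lemma average_le:
  assumes "finite S" "S \<noteq> {}" "\<And>x. x \<in> S \<Longrightarrow> (\<Sum>y\<in>F. pair_norm L (u y x)) \<le> c"
  shows "(\<Sum>y\<in>F. pair_norm L (\<lambda>b. \<Sum>x\<in>S. 1 / real (card S) * u y x b)) \<le> c"
proof -
  have "(\<Sum>y\<in>F. pair_norm L (\<lambda>b. \<Sum>x\<in>S. 1 / real (card S) * u y x b))
      \<le> (\<Sum>y\<in>F. \<Sum>x\<in>S. 1 / real (card S) * pair_norm L (u y x))"
    by (intro sum_mono order_trans[OF pair_norm_sum[OF L]] pair_norm_mult_le order_refl) simp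
  also have "\<dots> = (\<Sum>x\<in>S. 1 / real (card S) * (\<Sum>y\<in>F. pair_norm L (u y x)))"
    by (subst sum.swap) (simp add: sum_distrib_left)
  also have "\<dots> \<le> (\<Sum>x\<in>S. 1 / real (card S) * c)"
    by (intro sum_mono mult_left_mono assms) auto
  also have "\<dots> = c" using assms by simp
  finally show ?thesis .
qed

lemma ks_corr_bound:
  assumes "finite S" "S \<noteq> {}"
  shows "pair_norm L (\<lambda>b. ks_corr \<rho> (g b) (\<sigma> b) i S) \<le> \<xi> ^ card S / 8"
proof -
  have "pair_norm L (\<lambda>b. ks_rhs \<rho> (g b) (\<sigma> b) i x (S - {x})) \<le> \<xi> ^ card S / 8" if "x \<in> S" for x
    using ks_rhs_bound[of "S - {x}" i x] card_Suc_Diff1[OF assms(1) that] assms(1)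
    by (simp del: power_Suc card_Diff_singleton card_Diff_insert)
  then show ?thesis
    using average_le[OF assms, where F = "{()}" and u = "\<lambda>_ x b. ks_rhs \<rho> (g b) (\<sigma> b) i x (S - {x})"
        and c = "\<xi> ^ card S / 8"] assms(2)
    by (simp add: ks_corr_def)
qed

lemma ks_corr_palm:
  assumes "finite F" "finite S"
  shows "(\<Sum>y\<in>F. pair_norm L (\<lambda>b. ks_corr \<rho> (g b) (\<sigma> b) (Some y) S - ks_corr \<rho> (g b) (\<sigma> b) None S))
    \<le> 3 * \<xi> ^ card S / 8"
proof (cases "S = {}")
  case False
  have "(\<Sum>y\<in>F. pair_norm L (\<lambda>b. \<Sum>x\<in>S. 1 / real (card S) *
      (ks_rhs \<rho> (g b) (\<sigma> b) (Some y) x (S - {x}) - ks_rhs \<rho> (g b) (\<sigma> b) None x (S - {x}))))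
    \<le> 3 * \<xi> ^ card S / 8"
  proof (rule average_le[OF assms(2) False])
    fix x assume "x \<in> S"
    then show "(\<Sum>y\<in>F. pair_norm L (\<lambda>b. ks_rhs \<rho> (g b) (\<sigma> b) (Some y) x (S - {x})
        - ks_rhs \<rho> (g b) (\<sigma> b) None x (S - {x}))) \<le> 3 * \<xi> ^ card S / 8"
      using ks_rhs_palm[OF assms(1), of "S - {x}" x] assms(2)
      by (simp add: card_Suc_Diff1 del: power_Suc card_Diff_singleton card_Diff_insert)
  qed
  then show ?thesis using False
    by (simp add: ks_corr_def right_diff_distrib sum_subtractf)
qed (use \<xi>_pos in \<open>simp add: ks_corr_def\<close>)

text \<open>The 18 is 3 * 2 * 3, from |1 + h|, the reciprocal of the sum, and
  \<open>ks_sum_palm_root\<close>. Since \<open>h\<close> is the same for both states, subtracting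
  it leaves their difference unchanged.\<close>

lemma ks_mayer_bound:
  assumes "finite F" "\<And>x. \<bar>1 + h x\<bar> \<le> 3"
  shows "(\<Sum>x\<in>F. pair_norm L (\<lambda>b. ks_mayer h \<rho> (g b) (\<sigma> b) x - h x)) \<le> 18 * \<delta>"
proof -
  let ?Q = "\<lambda>b i. ks_sum \<rho> (g b) (\<sigma> b i) 0 {}"
  have eq: "ks_mayer h \<rho> (g b) (\<sigma> b) x - h x
      = (1 + h x) * (1 / ?Q b (Some x)) * - (?Q b (Some x) - ?Q b None)" for b x
    using ks_sum_pos[of b "Some x" 0] unfolding ks_mayer_def by (simp add: field_simps)
  have "(\<Sum>x\<in>F. pair_norm L (\<lambda>b. ks_mayer h \<rho> (g b) (\<sigma> b) x - h x))
      \<le> (\<Sum>x\<in>F. 3 * 2 * pair_norm L (\<lambda>b. ?Q b (Some x) - ?Q b None))"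
    unfolding eq
    by (intro sum_mono pair_norm_mult_le ks_sum_inverse_le) (auto simp: assms pair_norm_minus simp del: minus_diff_eq)
  also have "\<dots> \<le> 6 * (3 * \<delta>)"
    using ks_sum_palm_root[OF assms(1), of 0] by (simp flip: sum_distrib_left)
  finally show ?thesis by simp
qed

end

section \<open>The fixed point\<close>

definition lattice_symmetry :: "('v::ab_group_add \<Rightarrow> 'v) \<Rightarrow> bool" where
  "lattice_symmetry \<phi> \<longleftrightarrow> \<phi> = uminus \<or> (\<exists>a. \<phi> = (\<lambda>x. x + a))"

lemma lattice_symmetry_bij: "lattice_symmetry (\<phi> :: 'a::ab_group_add \<Rightarrow> 'a) \<Longrightarrow> bij \<phi>"
proof -
  have "bij (\<lambda>x. x + a)" for a :: 'a
    by (rule o_bij[of "\<lambda>x. x - a"]) (auto simp: fun_eq_iff)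
  moreover have "bij (uminus :: 'a \<Rightarrow> 'a)" by (rule bij_uminus)
  ultimately show "lattice_symmetry \<phi> \<Longrightarrow> bij \<phi>" unfolding lattice_symmetry_def by blast
qed

lemma lattice_symmetry_diff:
  "lattice_symmetry \<phi> \<Longrightarrow> (\<And>x. g (- x) = g x) \<Longrightarrow> g (\<phi> x - \<phi> y) = g (x - y)"
  unfolding lattice_symmetry_def by (metis add_diff_cancel_right minus_diff_eq minus_diff_minus)

text \<open>Reindexing the clusters by \<phi>. Two functions are needed because a symmetry also
  moves the conditioning point: \<open>s\<close> is the system conditioned at y, \<open>s'\<close>
  the one conditioned at \<phi> y.\<close>

lemma ks_sum_symmetry:
  assumes "lattice_symmetry \<phi>" "\<And>x. g (- x) = g x"
    and inv: "\<And>S. finite S \<Longrightarrow> s' (\<phi> ` S) = s S" and "finite Y"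
  shows "ks_sum \<rho> g s' (\<phi> x) (\<phi> ` Y) = ks_sum \<rho> g s x Y"
proof -
  have inj: "inj \<phi>" and surj: "surj \<phi>"
    using lattice_symmetry_bij[OF assms(1)] by (auto simp: bij_def)
  have bij: "bij_betw ((`) \<phi>) {T. finite T \<and> T \<inter> Y = {}} {T. finite T \<and> T \<inter> \<phi> ` Y = {}}"
  proof (rule bij_betw_byWitness[where f' = "(`) (inv \<phi>)"])
    show "(`) \<phi> ` {T. finite T \<and> T \<inter> Y = {}} \<subseteq> {T. finite T \<and> T \<inter> \<phi> ` Y = {}}"
      using inj by (auto simp: inj_def)
    show "(`) (inv \<phi>) ` {T. finite T \<and> T \<inter> \<phi> ` Y = {}} \<subseteq> {T. finite T \<and> T \<inter> Y = {}}"
      using surj by (auto simp: surj_f_inv_f) (metis disjoint_iff imageI surj_f_inv_f)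
  qed (use inj surj in \<open>auto simp: image_image surj_f_inv_f\<close>)
  have "ks_sum \<rho> g s' (\<phi> x) (\<phi> ` Y) = (\<Sum>\<^sub>\<infinity>T\<in>{T. finite T \<and> T \<inter> Y = {}}.
      (\<Prod>t\<in>\<phi> ` T. \<rho> * g (\<phi> x - t)) * s' (\<phi> ` Y \<union> \<phi> ` T))"
    unfolding ks_sum_def by (rule infsum_reindex_bij_betw[OF bij, symmetric])
  also have "\<dots> = ks_sum \<rho> g s x Y"
    unfolding ks_sum_def
  proof (rule infsum_cong)
    fix T assume "T \<in> {T. finite T \<and> T \<inter> Y = {}}"
    then have "s' (\<phi> ` Y \<union> \<phi> ` T) = s (Y \<union> T)"
      using inv[of "Y \<union> T"] assms(4) by (simp add: image_Un)
    moreover have "(\<Prod>t\<in>\<phi> ` T. \<rho> * g (\<phi> x - t)) = (\<Prod>t\<in>T. \<rho> * g (x - t))"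
      using inj by (subst prod.reindex)
        (auto simp: inj_on_def inj_def lattice_symmetry_diff[of _ g, OF assms(1,2)])
    ultimately show "(\<Prod>t\<in>\<phi> ` T. \<rho> * g (\<phi> x - t)) * s' (\<phi> ` Y \<union> \<phi> ` T)
        = (\<Prod>t\<in>T. \<rho> * g (x - t)) * s (Y \<union> T)" by simp
  qed
  finally show ?thesis .
qed

lemma ks_rhs_symmetry:
  assumes "lattice_symmetry \<phi>" "\<And>x. g (- x) = g x"
    and "\<And>i S. finite S \<Longrightarrow> \<sigma> (map_option \<phi> i) (\<phi> ` S) = \<sigma> i S" and "finite Y"
  shows "ks_rhs \<rho> g \<sigma> (map_option \<phi> i) (\<phi> x) (\<phi> ` Y) = ks_rhs \<rho> g \<sigma> i x Y"
proof -
  note diff = lattice_symmetry_diff[of _ g, OF assms(1,2)]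
  have inj: "inj \<phi>" using lattice_symmetry_bij[OF assms(1)] by (auto simp: bij_def)
  have "palm_weight g (map_option \<phi> i) (\<phi> x) = palm_weight g i x"
    by (cases i) (auto simp: palm_weight_def diff)
  moreover have "(\<Prod>y\<in>\<phi> ` Y. 1 + g (\<phi> x - y)) = (\<Prod>y\<in>Y. 1 + g (x - y))"
    using inj by (subst prod.reindex) (auto simp: inj_on_def inj_def diff)
  moreover have "ks_sum \<rho> g (\<sigma> (map_option \<phi> i)) (\<phi> x) (\<phi> ` Y) = ks_sum \<rho> g (\<sigma> i) x Y"
    by (rule ks_sum_symmetry) (use assms in auto)
  ultimately show ?thesis by (simp add: ks_rhs_def)
qed

lemma ks_corr_symmetry:
  assumes "lattice_symmetry \<phi>" "\<And>x. g (- x) = g x"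
    and "\<And>i S. finite S \<Longrightarrow> \<sigma> (map_option \<phi> i) (\<phi> ` S) = \<sigma> i S" and "finite S"
  shows "ks_corr \<rho> g \<sigma> (map_option \<phi> i) (\<phi> ` S) = ks_corr \<rho> g \<sigma> i S"
proof -
  have inj: "inj \<phi>" using lattice_symmetry_bij[OF assms(1)] by (auto simp: bij_def)
  have card: "card (\<phi> ` S) = card S" using inj by (simp add: card_image inj_on_def inj_def)
  have "(\<Sum>x\<in>\<phi> ` S. 1 / real (card S) * ks_rhs \<rho> g \<sigma> (map_option \<phi> i) x (\<phi> ` S - {x}))
      = (\<Sum>x\<in>S. 1 / real (card S) * ks_rhs \<rho> g \<sigma> (map_option \<phi> i) (\<phi> x) (\<phi> ` S - {\<phi> x}))"
    using inj by (subst sum.reindex) (auto simp: inj_on_def inj_def)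
  also have "\<dots> = (\<Sum>x\<in>S. 1 / real (card S) * ks_rhs \<rho> g \<sigma> i x (S - {x}))"
  proof (rule sum.cong)
    fix x
    have "\<phi> ` S - {\<phi> x} = \<phi> ` (S - {x})" using inj by (auto simp: inj_def)
    moreover have "ks_rhs \<rho> g \<sigma> (map_option \<phi> i) (\<phi> x) (\<phi> ` (S - {x})) = ks_rhs \<rho> g \<sigma> i x (S - {x})"
      by (rule ks_rhs_symmetry) (use assms in auto)
    ultimately show "1 / real (card S) * ks_rhs \<rho> g \<sigma> (map_option \<phi> i) (\<phi> x) (\<phi> ` S - {\<phi> x})
        = 1 / real (card S) * ks_rhs \<rho> g \<sigma> i x (S - {x})"
      by simp
  qed simp
  finally show ?thesis by (simp add: ks_corr_def card)
qed

lemma ks_mayer_even: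
  assumes "\<And>x. h (- x) = h x" "\<And>x. g (- x) = g x"
    and "\<And>\<phi> i S. lattice_symmetry \<phi> \<Longrightarrow> finite S \<Longrightarrow> \<sigma> (map_option \<phi> i) (\<phi> ` S) = \<sigma> i S"
  shows "ks_mayer h \<rho> g \<sigma> (- x) = ks_mayer h \<rho> g \<sigma> x"
proof -
  have sym: "lattice_symmetry (uminus :: 'a \<Rightarrow> 'a)" by (simp add: lattice_symmetry_def)
  have "ks_sum \<rho> g (\<sigma> (Some (- x))) (- 0) (uminus ` {}) = ks_sum \<rho> g (\<sigma> (Some x)) 0 {}"
    by (rule ks_sum_symmetry) (use sym assms(2) assms(3)[OF sym, of _ "Some x"] in auto)
  then show ?thesis by (simp add: ks_mayer_def assms(1))
qed

section \<open>The iteration and its contraction\<close>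

primrec ks_iterate ::
    "('v \<Rightarrow> real) \<Rightarrow> real \<Rightarrow> nat \<Rightarrow> ('v::ab_group_add option \<Rightarrow> 'v set \<Rightarrow> real) \<times> ('v \<Rightarrow> real)" where
  "ks_iterate h \<rho> 0 = (\<lambda>i S. if S = {} then 1 else 0, h)"
| "ks_iterate h \<rho> (Suc n) =
    (ks_corr \<rho> (snd (ks_iterate h \<rho> n)) (fst (ks_iterate h \<rho> n)),
     ks_mayer h \<rho> (snd (ks_iterate h \<rho> n)) (fst (ks_iterate h \<rho> n)))"

lemma convergent_geometric:
  fixes x :: "nat \<Rightarrow> real"
  assumes "\<And>n m. \<bar>x n - x (n + m)\<bar> \<le> 2 / 2 ^ n * C"
  shows "convergent x"
proof -
  have "(\<lambda>n. 2 / 2 ^ n * C) \<longlonglongrightarrow> 0" by real_asymp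
  have "Cauchy x"
  proof (rule CauchyI')
    fix e :: real assume "0 < e"
    with \<open>(\<lambda>n. 2 / 2 ^ n * C) \<longlonglongrightarrow> 0\<close> have "\<forall>\<^sub>F n in sequentially. 2 / 2 ^ n * C < e"
      by (rule order_tendstoD(2))
    then obtain N where N: "\<And>n. n \<ge> N \<Longrightarrow> 2 / 2 ^ n * C < e"
      by (auto simp: eventually_sequentially)
    have "dist (x m) (x n) < e" if "m \<ge> N" "m < n" for m n
      using assms[of m "n - m"] N[OF that(1)] that(2) by (simp add: dist_real_def)
    then show "\<exists>M. \<forall>m\<ge>M. \<forall>n>m. dist (x m) (x n) < e" by blast
  qed
  then show ?thesis by (rule Cauchy_convergent)
qed

text \<open>In the application the 1 in 1 + r is |h 0|, and r bounds the rest. The factor 144 = 8 *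
  18 lets the change 18 \<delta> of the Mayer function fit both the room (1 - r)/2 around
  \<open>h\<close> and the contraction.\<close>

locale inverse_problem =
  fixes h :: "'v::ab_group_add \<Rightarrow> real" and r \<rho> \<xi> \<delta> :: real
  assumes r: "0 < r" "r < 1" and \<xi>: "64 * exp 6 \<le> \<xi>" and \<rho>: "0 < \<rho>"
    and \<delta>: "exp (\<xi> * (3 * \<rho>)) - 1 \<le> \<delta>" "144 * \<delta> \<le> 1 - r"
    and h_even: "\<And>x. h (- x) = h x"
    and h_sum: "\<And>F. finite F \<Longrightarrow> (\<Sum>x\<in>F. \<bar>h x\<bar>) \<le> 1 + r"
begin

text \<open>The quarters leave room for pairing two states: their sizes take at most half of the
  bounds in \<open>ks_pair\<close>, and L times their difference takes the other half. The radius (1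
  - r)/2 keeps \<open>g\<close> away from -1 wherever h \<ge> - r.\<close>

definition admissible :: "('v option \<Rightarrow> 'v set \<Rightarrow> real) \<Rightarrow> ('v \<Rightarrow> real) \<Rightarrow> bool" where
  "admissible \<sigma> g \<longleftrightarrow>
     (\<forall>i. \<sigma> i {} = 1) \<and>
     (\<forall>i S. finite S \<longrightarrow> S \<noteq> {} \<longrightarrow> \<bar>\<sigma> i S\<bar> \<le> \<xi> ^ card S / 4) \<and>
     (\<forall>F S. finite F \<longrightarrow> finite S \<longrightarrow>
        (\<Sum>y\<in>F. \<bar>\<sigma> (Some y) S - \<sigma> None S\<bar>) \<le> 3 * \<xi> ^ card S / 4) \<and>
     (\<forall>F. finite F \<longrightarrow> (\<Sum>x\<in>F. \<bar>g x - h x\<bar>) \<le> (1 - r) / 2) \<and>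
     (\<forall>x. g (- x) = g x) \<and>
     (\<forall>\<phi> i S. lattice_symmetry \<phi> \<longrightarrow> finite S \<longrightarrow> \<sigma> (map_option \<phi> i) (\<phi> ` S) = \<sigma> i S)"

lemma admissibleD:
  assumes "admissible \<sigma> g"
  shows "\<sigma> i {} = 1"
    and "finite S \<Longrightarrow> S \<noteq> {} \<Longrightarrow> \<bar>\<sigma> i S\<bar> \<le> \<xi> ^ card S / 4"
    and "finite F \<Longrightarrow> finite S \<Longrightarrow>
      (\<Sum>y\<in>F. \<bar>\<sigma> (Some y) S - \<sigma> None S\<bar>) \<le> 3 * \<xi> ^ card S / 4"
    and "finite F \<Longrightarrow> (\<Sum>x\<in>F. \<bar>g x - h x\<bar>) \<le> (1 - r) / 2"
    and "g (- x) = g x"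
    and "lattice_symmetry \<phi> \<Longrightarrow> finite S \<Longrightarrow> \<sigma> (map_option \<phi> i) (\<phi> ` S) = \<sigma> i S"
  using assms unfolding admissible_def by blast+

text \<open>The weights are those of the bounds in \<open>ks_pair\<close>, so that one value of
  \<open>L\<close> serves all three components.\<close>

definition close ::
    "real \<Rightarrow> ('v option \<Rightarrow> 'v set \<Rightarrow> real) \<Rightarrow> ('v \<Rightarrow> real) \<Rightarrow>
      ('v option \<Rightarrow> 'v set \<Rightarrow> real) \<Rightarrow> ('v \<Rightarrow> real) \<Rightarrow> bool" where
  "close D \<sigma> g \<sigma>' g' \<longleftrightarrow>
     (\<forall>i S. finite S \<longrightarrow> \<bar>\<sigma> i S - \<sigma>' i S\<bar> \<le> D * \<xi> ^ card S) \<and>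
     (\<forall>F S. finite F \<longrightarrow> finite S \<longrightarrow>
        (\<Sum>y\<in>F. \<bar>(\<sigma> (Some y) S - \<sigma> None S) - (\<sigma>' (Some y) S - \<sigma>' None S)\<bar>)
          \<le> D * (3 * \<xi> ^ card S)) \<and>
     (\<forall>F. finite F \<longrightarrow> (\<Sum>x\<in>F. \<bar>g x - g' x\<bar>) \<le> D)"

lemma closeD:
  assumes "close D \<sigma> g \<sigma>' g'"
  shows "finite S \<Longrightarrow> \<bar>\<sigma> i S - \<sigma>' i S\<bar> \<le> D * \<xi> ^ card S"
    and "finite F \<Longrightarrow> finite S \<Longrightarrow>
      (\<Sum>y\<in>F. \<bar>(\<sigma> (Some y) S - \<sigma> None S) - (\<sigma>' (Some y) S - \<sigma>' None S)\<bar>)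
        \<le> D * (3 * \<xi> ^ card S)"
    and "finite F \<Longrightarrow> (\<Sum>x\<in>F. \<bar>g x - g' x\<bar>) \<le> D"
  using assms unfolding close_def by blast+

lemma \<xi>_pos: "0 < \<xi>"
  using \<xi> exp_gt_zero[of "6::real"] by linarith

lemma h_bound: "\<bar>1 + h x\<bar> \<le> 3"
  using h_sum[of "{x}"] r by auto

text \<open>With L = 1/(2D) the difference terms cost half of each correlation bound. For the Mayer
  functions the count is (1 + r) + 2 (1 - r)/2 + 1/2 = 5/2, within the allowed 3.\<close>

lemma ks_pair_close:
  assumes adm: "admissible \<sigma> g" "admissible \<sigma>' g'" and D: "0 < D" "close D \<sigma> g \<sigma>' g'"
  shows "ks_pair (1 / (2 * D)) \<xi> \<rho> \<delta> (\<lambda>b. if b then g else g') (\<lambda>b. if b then \<sigma> else \<sigma>')"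
proof (unfold_locales)
  let ?L = "1 / (2 * D)"
  show "0 \<le> ?L" using D by simp
  show "64 * exp 6 \<le> \<xi>" "0 < \<rho>" "exp (\<xi> * (3 * \<rho>)) - 1 \<le> \<delta>" "\<delta> \<le> 1 / 2"
    using \<xi> \<rho> \<delta> r by auto
  fix b :: bool and i :: "'v option"
  show "(if b then \<sigma> else \<sigma>') i {} = 1" using admissibleD(1)[OF adm(1)] admissibleD(1)[OF adm(2)] by simp
next
  fix i :: "'v option" and S :: "'v set" assume S: "finite S"
  show "pair_norm (1 / (2 * D)) (\<lambda>b. (if b then \<sigma> else \<sigma>') i S) \<le> \<xi> ^ card S"
  proof (cases "S = {}")
    case True
    then show ?thesis
      using admissibleD(1)[OF adm(1)] admissibleD(1)[OF adm(2)] by (simp add: pair_norm_def)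
  next
    case False
    have "1 / (2 * D) * \<bar>\<sigma> i S - \<sigma>' i S\<bar> \<le> 1 / (2 * D) * (D * \<xi> ^ card S)"
      using closeD(1)[OF D(2) S] D(1) by (intro mult_left_mono) auto
    also have "\<dots> = \<xi> ^ card S / 2" using D(1) by simp
    finally show ?thesis
      using admissibleD(2)[OF adm(1) S False, of i] admissibleD(2)[OF adm(2) S False, of i]
        zero_less_power[OF \<xi>_pos, of "card S"]
      unfolding pair_norm_def by auto
  qed
next
  fix F S :: "'v set" assume fin: "finite F" "finite S"
  let ?u = "\<lambda>y. \<sigma> (Some y) S - \<sigma> None S" and ?v = "\<lambda>y. \<sigma>' (Some y) S - \<sigma>' None S"
  have "(\<Sum>y\<in>F. pair_norm (1 / (2 * D))
      (\<lambda>b. (if b then \<sigma> else \<sigma>') (Some y) S - (if b then \<sigma> else \<sigma>') None S))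
      \<le> (\<Sum>y\<in>F. \<bar>?u y\<bar> + \<bar>?v y\<bar> + 1 / (2 * D) * \<bar>?u y - ?v y\<bar>)"
    unfolding pair_norm_def by (intro sum_mono) auto
  also have "\<dots> = (\<Sum>y\<in>F. \<bar>?u y\<bar>) + (\<Sum>y\<in>F. \<bar>?v y\<bar>) + 1 / (2 * D) * (\<Sum>y\<in>F. \<bar>?u y - ?v y\<bar>)"
    by (simp only: sum.distrib sum_distrib_left)
  also have "\<dots> \<le> 3 * \<xi> ^ card S / 4 + 3 * \<xi> ^ card S / 4 + 1 / (2 * D) * (D * (3 * \<xi> ^ card S))"
    using D(1) by (intro add_mono mult_left_mono closeD(2)[OF D(2)] admissibleD(3)[OF adm(1)]
        admissibleD(3)[OF adm(2)] fin) auto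
  also have "\<dots> = 3 * \<xi> ^ card S" using D(1) by simp
  finally show "(\<Sum>y\<in>F. pair_norm (1 / (2 * D))
      (\<lambda>b. (if b then \<sigma> else \<sigma>') (Some y) S - (if b then \<sigma> else \<sigma>') None S)) \<le> 3 * \<xi> ^ card S" .
next
  fix F :: "'v set" assume fin: "finite F"
  have "(\<Sum>x\<in>F. pair_norm (1 / (2 * D)) (\<lambda>b. (if b then g else g') x))
      \<le> (\<Sum>x\<in>F. \<bar>h x\<bar> + \<bar>g x - h x\<bar> + \<bar>g' x - h x\<bar> + 1 / (2 * D) * \<bar>g x - g' x\<bar>)"
    unfolding pair_norm_def by (intro sum_mono) auto
  also have "\<dots> = (\<Sum>x\<in>F. \<bar>h x\<bar>) + (\<Sum>x\<in>F. \<bar>g x - h x\<bar>) + (\<Sum>x\<in>F. \<bar>g' x - h x\<bar>)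
      + 1 / (2 * D) * (\<Sum>x\<in>F. \<bar>g x - g' x\<bar>)"
    by (simp only: sum.distrib sum_distrib_left)
  also have "\<dots> \<le> (1 + r) + (1 - r) / 2 + (1 - r) / 2 + 1 / (2 * D) * D"
    using D(1) by (intro add_mono mult_left_mono closeD(3)[OF D(2)] admissibleD(4)[OF adm(1)]
        admissibleD(4)[OF adm(2)] h_sum fin) auto
  also have "\<dots> \<le> 3" using D(1) r by (simp add: field_simps)
  finally show "(\<Sum>x\<in>F. pair_norm (1 / (2 * D)) (\<lambda>b. (if b then g else g') x)) \<le> 3" .
qed

text \<open>A crude triangle inequality that starts the geometric estimate and also allows a state
  to be paired with itself.\<close>

lemma admissible_close:
  assumes adm: "admissible \<sigma> g" "admissible \<sigma>' g'"
  shows "close 1 \<sigma> g \<sigma>' g'"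
  unfolding close_def
proof (intro conjI allI impI)
  fix i :: "'v option" and S :: "'v set" assume S: "finite S"
  have "0 < \<xi> ^ card S" using \<xi>_pos by simp
  then show "\<bar>\<sigma> i S - \<sigma>' i S\<bar> \<le> 1 * \<xi> ^ card S"
    using admissibleD(1)[OF adm(1), of i] admissibleD(2)[OF adm(1), of S i]
      admissibleD(1)[OF adm(2), of i] admissibleD(2)[OF adm(2), of S i] S
    by (cases "S = {}") (force simp: abs_le_iff)+
next
  fix F S :: "'v set" assume fin: "finite F" "finite S"
  have "(\<Sum>y\<in>F. \<bar>(\<sigma> (Some y) S - \<sigma> None S) - (\<sigma>' (Some y) S - \<sigma>' None S)\<bar>)
      \<le> (\<Sum>y\<in>F. \<bar>\<sigma> (Some y) S - \<sigma> None S\<bar> + \<bar>\<sigma>' (Some y) S - \<sigma>' None S\<bar>)"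
    by (intro sum_mono) auto
  also have "\<dots> \<le> 3 * \<xi> ^ card S / 4 + 3 * \<xi> ^ card S / 4"
    unfolding sum.distrib
    by (intro add_mono admissibleD(3)[OF adm(1)] admissibleD(3)[OF adm(2)] fin)
  also have "\<dots> \<le> 1 * (3 * \<xi> ^ card S)" using \<xi>_pos by simp
  finally show "(\<Sum>y\<in>F. \<bar>(\<sigma> (Some y) S - \<sigma> None S) - (\<sigma>' (Some y) S - \<sigma>' None S)\<bar>)
      \<le> 1 * (3 * \<xi> ^ card S)" .
next
  fix F :: "'v set" assume fin: "finite F"
  have "(\<Sum>x\<in>F. \<bar>g x - g' x\<bar>) \<le> (\<Sum>x\<in>F. \<bar>g x - h x\<bar> + \<bar>g' x - h x\<bar>)"
    by (intro sum_mono) auto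
  also have "\<dots> \<le> (1 - r) / 2 + (1 - r) / 2"
    unfolding sum.distrib
    by (intro add_mono admissibleD(4)[OF adm(1)] admissibleD(4)[OF adm(2)] fin)
  also have "\<dots> \<le> 1" using r by simp
  finally show "(\<Sum>x\<in>F. \<bar>g x - g' x\<bar>) \<le> 1" .
qed

lemma admissible_ks_pair:
  assumes "admissible \<sigma> g"
  shows "ks_pair (1 / 2) \<xi> \<rho> \<delta> (\<lambda>_. g) (\<lambda>_. \<sigma>)"
  using ks_pair_close[OF assms assms _ admissible_close[OF assms assms]] by simp

lemma admissible_step:
  assumes adm: "admissible \<sigma> g"
  shows "admissible (ks_corr \<rho> g \<sigma>) (ks_mayer h \<rho> g \<sigma>)"
  unfolding admissible_def
proof (intro conjI allI impI)
  have \<delta>_le: "18 * \<delta> \<le> (1 - r) / 2" using \<delta>(2) r by simp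
  interpret ks_pair "1 / 2" \<xi> \<rho> \<delta> "\<lambda>_. g" "\<lambda>_. \<sigma>" by (rule admissible_ks_pair[OF adm])
  fix i :: "'v option" and F S :: "'v set"
  show "ks_corr \<rho> g \<sigma> i {} = 1" by (simp add: ks_corr_def)
  have pos: "0 < \<xi> ^ card S" using \<xi>_pos by simp
  show "\<bar>ks_corr \<rho> g \<sigma> i S\<bar> \<le> \<xi> ^ card S / 4" if "finite S" "S \<noteq> {}"
    using ks_corr_bound[OF that, of i] pos by simp
  show "(\<Sum>y\<in>F. \<bar>ks_corr \<rho> g \<sigma> (Some y) S - ks_corr \<rho> g \<sigma> None S\<bar>) \<le> 3 * \<xi> ^ card S / 4"
    if "finite F" "finite S"
    using ks_corr_palm[OF that] pos by simp
  show "(\<Sum>x\<in>F. \<bar>ks_mayer h \<rho> g \<sigma> x - h x\<bar>) \<le> (1 - r) / 2" if "finite F"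
    using ks_mayer_bound[OF that, of h, OF h_bound] \<delta>_le by simp
  show "ks_mayer h \<rho> g \<sigma> (- x) = ks_mayer h \<rho> g \<sigma> x" for x
    by (intro ks_mayer_even h_even admissibleD(5,6)[OF adm])
  show "ks_corr \<rho> g \<sigma> (map_option \<phi> i) (\<phi> ` S) = ks_corr \<rho> g \<sigma> i S"
    if "lattice_symmetry \<phi>" "finite S" for \<phi>
    by (intro ks_corr_symmetry that admissibleD(5,6)[OF adm])
qed

text \<open>A bound B for the image of the pair in the norm with L = 1/(2D) bounds the difference of
  the images by 2 D B. The image bounds carry factors 1/8, and 18 \<delta> \<le> 1/8, so the
  distance in fact drops to D/4.\<close>

lemma close_step:
  assumes adm: "admissible \<sigma> g" "admissible \<sigma>' g'" and D: "0 < D" "close D \<sigma> g \<sigma>' g'"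
  shows "close (D / 2) (ks_corr \<rho> g \<sigma>) (ks_mayer h \<rho> g \<sigma>)
    (ks_corr \<rho> g' \<sigma>') (ks_mayer h \<rho> g' \<sigma>')"
proof -
  let ?g = "\<lambda>b. if b then g else g'" and ?\<sigma> = "\<lambda>b. if b then \<sigma> else \<sigma>'"
  have "2 * D * (18 * \<delta>) \<le> 2 * D * (1 / 8)" using \<delta>(2) r D(1) by (intro mult_left_mono) auto
  then have \<delta>_le: "2 * D * (18 * \<delta>) \<le> D / 2" using D(1) by simp
  interpret ks_pair "1 / (2 * D)" \<xi> \<rho> \<delta> ?g ?\<sigma> by (rule ks_pair_close[OF adm D])
  have sum_diff: "(\<Sum>y\<in>F. \<bar>u y True - u y False\<bar>) \<le> 2 * D * B"
    if "(\<Sum>y\<in>F. pair_norm (1 / (2 * D)) (u y)) \<le> B" for F :: "'b set" and u B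
  proof -
    have "1 / (2 * D) * (\<Sum>y\<in>F. \<bar>u y True - u y False\<bar>) \<le> B"
      unfolding sum_distrib_left
      by (rule order_trans[OF sum_mono that]) (rule diff_le_pair_norm)
    then show ?thesis using D(1) by (simp add: field_simps)
  qed
  show ?thesis
    unfolding close_def
  proof (intro conjI allI impI)
    fix i :: "'v option" and S :: "'v set" assume S: "finite S"
    show "\<bar>ks_corr \<rho> g \<sigma> i S - ks_corr \<rho> g' \<sigma>' i S\<bar> \<le> D / 2 * \<xi> ^ card S"
    proof (cases "S = {}")
      case False
      then show ?thesis
        using sum_diff[of "\<lambda>_ b. ks_corr \<rho> (?g b) (?\<sigma> b) i S" "{()}" "\<xi> ^ card S / 8"]
          ks_corr_bound[OF S False, of i] mult_pos_pos[OF D(1) zero_less_power[OF \<xi>_pos, of "card S"]]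
        by simp
    qed (use D in \<open>simp add: ks_corr_def\<close>)
  next
    fix F S :: "'v set" assume fin: "finite F" "finite S"
    have "0 < D * \<xi> ^ card S" using D(1) \<xi>_pos by simp
    then show "(\<Sum>y\<in>F. \<bar>(ks_corr \<rho> g \<sigma> (Some y) S - ks_corr \<rho> g \<sigma> None S)
        - (ks_corr \<rho> g' \<sigma>' (Some y) S - ks_corr \<rho> g' \<sigma>' None S)\<bar>) \<le> D / 2 * (3 * \<xi> ^ card S)"
      using sum_diff[OF ks_corr_palm[OF fin]] by simp
  next
    fix F :: "'v set" assume fin: "finite F"
    have "(\<Sum>x\<in>F. \<bar>ks_mayer h \<rho> g \<sigma> x - ks_mayer h \<rho> g' \<sigma>' x\<bar>) \<le> 2 * D * (18 * \<delta>)"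
      using sum_diff[OF ks_mayer_bound[OF fin, of h, OF h_bound]] by simp
    also have "\<dots> \<le> D / 2" by (rule \<delta>_le)
    finally show "(\<Sum>x\<in>F. \<bar>ks_mayer h \<rho> g \<sigma> x - ks_mayer h \<rho> g' \<sigma>' x\<bar>) \<le> D / 2" .
  qed
qed

lemma close_refl: "close 0 \<sigma> g \<sigma> g"
  by (simp add: close_def)

lemma close_trans:
  assumes "close D \<sigma> g \<sigma>' g'" "close E \<sigma>' g' \<sigma>'' g''"
  shows "close (D + E) \<sigma> g \<sigma>'' g''"
  unfolding close_def
proof (intro conjI allI impI)
  fix i :: "'v option" and S :: "'v set" assume S: "finite S"
  show "\<bar>\<sigma> i S - \<sigma>'' i S\<bar> \<le> (D + E) * \<xi> ^ card S"
    using closeD(1)[OF assms(1) S, of i] closeD(1)[OF assms(2) S, of i] by (simp add: distrib_right)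
next
  fix F S :: "'v set" assume fin: "finite F" "finite S"
  have "(\<Sum>y\<in>F. \<bar>(\<sigma> (Some y) S - \<sigma> None S) - (\<sigma>'' (Some y) S - \<sigma>'' None S)\<bar>)
      \<le> (\<Sum>y\<in>F. \<bar>(\<sigma> (Some y) S - \<sigma> None S) - (\<sigma>' (Some y) S - \<sigma>' None S)\<bar>
        + \<bar>(\<sigma>' (Some y) S - \<sigma>' None S) - (\<sigma>'' (Some y) S - \<sigma>'' None S)\<bar>)"
    by (intro sum_mono) auto
  also have "\<dots> \<le> (D + E) * (3 * \<xi> ^ card S)"
    unfolding sum.distrib distrib_right
    by (intro add_mono closeD(2)[OF assms(1)] closeD(2)[OF assms(2)] fin)
  finally show "(\<Sum>y\<in>F. \<bar>(\<sigma> (Some y) S - \<sigma> None S) - (\<sigma>'' (Some y) S - \<sigma>'' None S)\<bar>)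
      \<le> (D + E) * (3 * \<xi> ^ card S)" .
next
  fix F :: "'v set" assume fin: "finite F"
  have "(\<Sum>x\<in>F. \<bar>g x - g'' x\<bar>) \<le> (\<Sum>x\<in>F. \<bar>g x - g' x\<bar> + \<bar>g' x - g'' x\<bar>)"
    by (intro sum_mono) auto
  also have "\<dots> \<le> D + E"
    unfolding sum.distrib by (intro add_mono closeD(3)[OF assms(1)] closeD(3)[OF assms(2)] fin)
  finally show "(\<Sum>x\<in>F. \<bar>g x - g'' x\<bar>) \<le> D + E" .
qed

abbreviation "iter_corr n \<equiv> fst (ks_iterate h \<rho> n)"
abbreviation "iter_mayer n \<equiv> snd (ks_iterate h \<rho> n)"

lemma admissible_iterate: "admissible (iter_corr n) (iter_mayer n)"
proof (induction n)
  case 0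
  show ?case using \<xi>_pos r h_even by (simp add: admissible_def)
next
  case (Suc n)
  then show ?case by (simp add: admissible_step)
qed

lemma close_iterate_Suc:
  "close (1 / 2 ^ n) (iter_corr n) (iter_mayer n) (iter_corr (Suc n)) (iter_mayer (Suc n))"
proof (induction n)
  case 0
  show ?case using admissible_close[OF admissible_iterate[of 0] admissible_iterate[of 1]] by simp
next
  case (Suc n)
  show ?case
    using close_step[OF admissible_iterate[of n] admissible_iterate[of "Suc n"] _ Suc]
    by (simp add: field_simps)
qed

lemma close_iterate:
  "close (2 / 2 ^ n) (iter_corr n) (iter_mayer n) (iter_corr (n + m)) (iter_mayer (n + m))"
proof -
  have 1: "close (2 / 2 ^ n - 2 / 2 ^ (n + m)) (iter_corr n) (iter_mayer n)
      (iter_corr (n + m)) (iter_mayer (n + m))"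
  proof (induction m)
    case (Suc m)
    have "(2 / 2 ^ n - 2 / 2 ^ (n + m)) + 1 / 2 ^ (n + m) = (2 / 2 ^ n - 2 / 2 ^ (n + Suc m) :: real)"
      by (simp add: field_simps)
    then show ?case using close_trans[OF Suc close_iterate_Suc[of "n + m"]] by (simp del: ks_iterate.simps)
  qed (simp add: close_refl)
  \<comment> \<open>A state is within any nonnegative distance of itself; adding this one pads the
    telescoped bound to 2 / 2^n.\<close>
  have 2: "close (2 / 2 ^ (n + m)) (iter_corr (n + m)) (iter_mayer (n + m))
      (iter_corr (n + m)) (iter_mayer (n + m))"
    using \<xi>_pos by (simp add: close_def)
  show ?thesis using close_trans[OF 1 2] by simp
qed

lemma ks_fixed_point:
  obtains \<sigma> g where "admissible \<sigma> g" "\<And>i S. finite S \<Longrightarrow> ks_corr \<rho> g \<sigma> i S = \<sigma> i S"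
    "\<And>x. ks_mayer h \<rho> g \<sigma> x = g x"
proof -
  define \<sigma> where "\<sigma> i S = lim (\<lambda>n. iter_corr n i S)" for i S
  define g where "g x = lim (\<lambda>n. iter_mayer n x)" for x
  have \<sigma>: "(\<lambda>n. iter_corr n i S) \<longlonglongrightarrow> \<sigma> i S" if "finite S" for i S
    unfolding \<sigma>_def convergent_LIMSEQ_iff[symmetric]
    by (rule convergent_geometric[where C = "\<xi> ^ card S"]) (rule closeD(1)[OF close_iterate that])
  have g: "(\<lambda>n. iter_mayer n x) \<longlonglongrightarrow> g x" for x
    unfolding g_def convergent_LIMSEQ_iff[symmetric]
    by (rule convergent_geometric[where C = 1]) (use closeD(3)[OF close_iterate, of "{x}"] in simp)
  note adm = admissibleD[OF admissible_iterate]
  have A: "admissible \<sigma> g"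
    unfolding admissible_def
  proof (intro conjI allI impI)
    fix i :: "'v option" and F S :: "'v set"
    show "\<sigma> i {} = 1" using \<sigma>[of "{}" i] by (simp add: adm(1) LIMSEQ_const_iff)
    show "\<bar>\<sigma> i S\<bar> \<le> \<xi> ^ card S / 4" if "finite S" "S \<noteq> {}"
      by (rule LIMSEQ_le_const2[OF tendsto_rabs[OF \<sigma>[OF that(1)]]]) (use adm(2) that in blast)
    show "(\<Sum>y\<in>F. \<bar>\<sigma> (Some y) S - \<sigma> None S\<bar>) \<le> 3 * \<xi> ^ card S / 4" if "finite F" "finite S"
    proof (rule LIMSEQ_le_const2)
      show "(\<lambda>n. \<Sum>y\<in>F. \<bar>iter_corr n (Some y) S - iter_corr n None S\<bar>)
          \<longlonglongrightarrow> (\<Sum>y\<in>F. \<bar>\<sigma> (Some y) S - \<sigma> None S\<bar>)"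
        by (intro tendsto_intros \<sigma> that)
    qed (use adm(3) that in blast)
    show "(\<Sum>x\<in>F. \<bar>g x - h x\<bar>) \<le> (1 - r) / 2" if "finite F"
    proof (rule LIMSEQ_le_const2)
      show "(\<lambda>n. \<Sum>x\<in>F. \<bar>iter_mayer n x - h x\<bar>) \<longlonglongrightarrow> (\<Sum>x\<in>F. \<bar>g x - h x\<bar>)"
        by (intro tendsto_intros g)
    qed (use adm(4) that in blast)
    show "g (- x) = g x" for x
      using g[of "- x"] g[of x] by (simp add: adm(5) LIMSEQ_unique)
    show "\<sigma> (map_option \<phi> i) (\<phi> ` S) = \<sigma> i S" if "lattice_symmetry \<phi>" "finite S" for \<phi>
      using \<sigma>[of "\<phi> ` S" "map_option \<phi> i"] \<sigma>[of S i] that by (simp add: adm(6) LIMSEQ_unique)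
  qed
  have C: "close (2 / 2 ^ n) (iter_corr n) (iter_mayer n) \<sigma> g" for n
    unfolding close_def
  proof (intro conjI allI impI)
    note ign = LIMSEQ_ignore_initial_segment[of _ _ n]
    fix i :: "'v option" and F S :: "'v set"
    show "\<bar>iter_corr n i S - \<sigma> i S\<bar> \<le> 2 / 2 ^ n * \<xi> ^ card S" if "finite S"
    proof (rule LIMSEQ_le_const2)
      show "(\<lambda>m. \<bar>iter_corr n i S - iter_corr (m + n) i S\<bar>) \<longlonglongrightarrow> \<bar>iter_corr n i S - \<sigma> i S\<bar>"
        by (intro tendsto_intros ign \<sigma> that)
    qed (use closeD(1)[OF close_iterate that, of n] in \<open>simp add: add.commute\<close>)
    show "(\<Sum>y\<in>F. \<bar>(iter_corr n (Some y) S - iter_corr n None S) - (\<sigma> (Some y) S - \<sigma> None S)\<bar>)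
        \<le> 2 / 2 ^ n * (3 * \<xi> ^ card S)" if "finite F" "finite S"
    proof (rule LIMSEQ_le_const2)
      show "(\<lambda>m. \<Sum>y\<in>F. \<bar>(iter_corr n (Some y) S - iter_corr n None S)
            - (iter_corr (m + n) (Some y) S - iter_corr (m + n) None S)\<bar>)
          \<longlonglongrightarrow> (\<Sum>y\<in>F. \<bar>(iter_corr n (Some y) S - iter_corr n None S) - (\<sigma> (Some y) S - \<sigma> None S)\<bar>)"
        by (intro tendsto_intros ign \<sigma> that)
    qed (use closeD(2)[OF close_iterate that, of n] in \<open>simp add: add.commute\<close>)
    show "(\<Sum>x\<in>F. \<bar>iter_mayer n x - g x\<bar>) \<le> 2 / 2 ^ n" if "finite F"
    proof (rule LIMSEQ_le_const2)
      show "(\<lambda>m. \<Sum>x\<in>F. \<bar>iter_mayer n x - iter_mayer (m + n) x\<bar>) \<longlonglongrightarrow> (\<Sum>x\<in>F. \<bar>iter_mayer n x - g x\<bar>)"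
        by (intro tendsto_intros ign g)
    qed (use closeD(3)[OF close_iterate that, of n] in \<open>simp add: add.commute\<close>)
  qed
  \<comment> \<open>This replaces continuity of the map: the limit is admissible and near the n-th
    iterate, so one contraction step puts its image near the next iterate. The image and the limit
    are then limits of the same sequence.\<close>
  have S: "close (2 / 2 ^ n / 2) (iter_corr (Suc n)) (iter_mayer (Suc n))
      (ks_corr \<rho> g \<sigma>) (ks_mayer h \<rho> g \<sigma>)" for n
    using close_step[OF admissible_iterate A _ C, of n] by simp
  have lim: "x = y" if "(\<lambda>n. a n) \<longlonglongrightarrow> x" "\<And>n. \<bar>a (Suc n) - y\<bar> \<le> 2 / 2 ^ n / 2 * c"
    for a :: "nat \<Rightarrow> real" and x y c
  proof -
    have "(\<lambda>n. 2 / 2 ^ n / 2 * c) \<longlonglongrightarrow> 0" by real_asymp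
    then have "(\<lambda>n. a (Suc n) - y) \<longlonglongrightarrow> 0"
      by (rule Lim_null_comparison[rotated]) (use that(2) in \<open>auto intro!: always_eventually\<close>)
    then have "(\<lambda>n. a (Suc n)) \<longlonglongrightarrow> y" by (simp add: LIM_zero_iff)
    then show ?thesis using LIMSEQ_Suc[OF that(1)] LIMSEQ_unique by blast
  qed
  show ?thesis
  proof (rule that[OF A])
    show "ks_corr \<rho> g \<sigma> i S = \<sigma> i S" if "finite S" for i S
      using lim[OF \<sigma>[OF that, of i] closeD(1)[OF S that, of _ i]] by simp
    show "ks_mayer h \<rho> g \<sigma> x = g x" for x
      using lim[OF g[of x], of "ks_mayer h \<rho> g \<sigma> x" 1] closeD(3)[OF S, of "{x}"] by simp
  qed
qed

end

section \<open>Convergence of the finite-volume correlations\<close>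

text \<open>The square root compensates for every unordered pair occurring twice in the product.\<close>

definition pair_weight :: "('v::ab_group_add \<Rightarrow> real) \<Rightarrow> 'v set \<Rightarrow> real" where
  "pair_weight f U = sqrt (\<Prod>x\<in>U. \<Prod>y\<in>U - {x}. f (x - y))"

definition activity_weight ::
    "('v \<Rightarrow> real) \<Rightarrow> ('v::ab_group_add \<Rightarrow> real) \<Rightarrow> 'v set \<Rightarrow> real" where
  "activity_weight \<zeta> f U = (\<Prod>u\<in>U. \<zeta> u) * pair_weight f U"

text \<open>For constant activity this is the partition function times the correlation function of
  \<open>S\<close>, summed over the whole configuration rather than over the additional particles;
  at \<open>S = {}\<close> it is the partition function.\<close>

definition gibbs_sum ::
    "'v set \<Rightarrow> ('v \<Rightarrow> real) \<Rightarrow> ('v::ab_group_add \<Rightarrow> real) \<Rightarrow> 'v set \<Rightarrow> real" where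
  "gibbs_sum \<Lambda> \<zeta> f S = (\<Sum>U | S \<subseteq> U \<and> U \<subseteq> \<Lambda>. activity_weight \<zeta> f U)"

lemma gibbs_sum_outside: "\<not> S \<subseteq> \<Lambda> \<Longrightarrow> gibbs_sum \<Lambda> \<zeta> f S = 0"
proof -
  assume "\<not> S \<subseteq> \<Lambda>"
  then have "{U. S \<subseteq> U \<and> U \<subseteq> \<Lambda>} = {}" by auto
  then show ?thesis unfolding gibbs_sum_def by (simp only: sum.empty)
qed

locale even_weight =
  fixes f :: "'v::ab_group_add \<Rightarrow> real"
  assumes f_nonneg: "\<And>x. 0 \<le> f x" and f_even: "\<And>x. f (- x) = f x" and f_zero: "f 0 = 0"
begin

lemma pair_weight_nonneg: "0 \<le> pair_weight f U"
  unfolding pair_weight_def by (intro real_sqrt_ge_zero prod_nonneg) (simp add: f_nonneg prod_nonneg)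

lemma f_commute: "f (x - y) = f (y - x)"
  using f_even[of "y - x"] by simp

lemma pair_weight_insert:
  assumes "finite U" "a \<notin> U"
  shows "pair_weight f (insert a U) = (\<Prod>y\<in>U. f (a - y)) * pair_weight f U"
proof -
  have "(\<Prod>y\<in>insert a U - {x}. f (x - y)) = f (x - a) * (\<Prod>y\<in>U - {x}. f (x - y))" if "x \<in> U" for x
  proof -
    have "insert a U - {x} = insert a (U - {x})" using that assms by auto
    then show ?thesis using assms by simp
  qed
  then have "(\<Prod>x\<in>U. \<Prod>y\<in>insert a U - {x}. f (x - y))
      = (\<Prod>x\<in>U. f (a - x)) * (\<Prod>x\<in>U. \<Prod>y\<in>U - {x}. f (x - y))"
    by (simp add: prod.distrib f_commute[of a])
  then have "(\<Prod>x\<in>insert a U. \<Prod>y\<in>insert a U - {x}. f (x - y))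
      = (\<Prod>y\<in>U. f (a - y))\<^sup>2 * (\<Prod>x\<in>U. \<Prod>y\<in>U - {x}. f (x - y))"
    using assms by (simp add: power2_eq_square insert_Diff_if)
  then show ?thesis
    unfolding pair_weight_def by (simp add: real_sqrt_mult prod_nonneg f_nonneg)
qed

lemma activity_weight_insert:
  assumes "finite U" "a \<notin> U"
  shows "activity_weight \<zeta> f (insert a U) = \<zeta> a * (\<Prod>y\<in>U. f (a - y)) * activity_weight \<zeta> f U"
  using assms by (simp add: activity_weight_def pair_weight_insert)

lemma prod_f_eq_zero: "finite U \<Longrightarrow> a \<in> U \<Longrightarrow> (\<Prod>y\<in>U. f (a - y)) = 0"
  using f_zero by (intro prod_zero bexI[of _ a]) auto

lemma insert_superset_bij:
  assumes "x \<notin> S"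
  shows "bij_betw (insert x) {V. S \<subseteq> V \<and> V \<subseteq> \<Lambda> - {x}} {U. insert x S \<subseteq> U \<and> U \<subseteq> insert x \<Lambda>}"
  by (rule bij_betw_byWitness[where f' = "\<lambda>U. U - {x}"]) (use assms in auto)

lemma gibbs_sum_insert:
  assumes "finite \<Lambda>" "x \<in> \<Lambda>" "x \<notin> S"
  shows "gibbs_sum \<Lambda> \<zeta> f (insert x S) =
    (\<Sum>V | S \<subseteq> V \<and> V \<subseteq> \<Lambda>. \<zeta> x * (\<Prod>v\<in>V. f (x - v)) * activity_weight \<zeta> f V)"
proof -
  have "insert x \<Lambda> = \<Lambda>" using assms by auto
  then have "gibbs_sum \<Lambda> \<zeta> f (insert x S)
      = (\<Sum>V | S \<subseteq> V \<and> V \<subseteq> \<Lambda> - {x}. activity_weight \<zeta> f (insert x V))"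
    unfolding gibbs_sum_def
    using sum.reindex_bij_betw[OF insert_superset_bij[OF assms(3), of \<Lambda>], of "activity_weight \<zeta> f"]
    by simp
  also have "\<dots> = (\<Sum>V | S \<subseteq> V \<and> V \<subseteq> \<Lambda> - {x}. \<zeta> x * (\<Prod>v\<in>V. f (x - v)) * activity_weight \<zeta> f V)"
    by (intro sum.cong refl activity_weight_insert) (use assms in \<open>auto dest: finite_subset\<close>)
  \<comment> \<open>Configurations already containing \<open>x\<close> may be put back, as the hard
    core \<open>f 0 = 0\<close> kills them. The index set becomes that of \<open>gibbs_sum\<close>
    at \<open>S\<close>.\<close>
  also have "\<dots> = (\<Sum>V | S \<subseteq> V \<and> V \<subseteq> \<Lambda>. \<zeta> x * (\<Prod>v\<in>V. f (x - v)) * activity_weight \<zeta> f V)"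
  proof (rule sum.mono_neutral_left)
    show "\<forall>V\<in>{V. S \<subseteq> V \<and> V \<subseteq> \<Lambda>} - {V. S \<subseteq> V \<and> V \<subseteq> \<Lambda> - {x}}.
        \<zeta> x * (\<Prod>v\<in>V. f (x - v)) * activity_weight \<zeta> f V = 0"
    proof
      fix V assume "V \<in> {V. S \<subseteq> V \<and> V \<subseteq> \<Lambda>} - {V. S \<subseteq> V \<and> V \<subseteq> \<Lambda> - {x}}"
      then have "x \<in> V" "finite V" using assms(1) by (auto dest: finite_subset)
      then show "\<zeta> x * (\<Prod>v\<in>V. f (x - v)) * activity_weight \<zeta> f V = 0"
        using prod_f_eq_zero by simp
    qed
  qed (use assms in auto)
  finally show ?thesis .
qed

text \<open>Expand the product of 1 + (f - 1) over the particles outside \<open>Y\<close> and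
  exchange the sums; the configurations above both \<open>Y\<close> and \<open>T\<close> form the
  Gibbs sum of their union. \<open>T\<close> may contain \<open>x\<close>, with factor -1, which is
  why l^1 bounds on the Mayer function include the origin.\<close>

lemma gibbs_sum_kirkwood_salsburg:
  assumes "finite \<Lambda>" "insert x Y \<subseteq> \<Lambda>" "x \<notin> Y"
  shows "gibbs_sum \<Lambda> \<zeta> f (insert x Y) = \<zeta> x * (\<Prod>y\<in>Y. f (x - y)) *
    (\<Sum>T\<in>Pow (\<Lambda> - Y). (\<Prod>t\<in>T. f (x - t) - 1) * gibbs_sum \<Lambda> \<zeta> f (Y \<union> T))"
proof -
  let ?V = "{V. Y \<subseteq> V \<and> V \<subseteq> \<Lambda>}" and ?w = "activity_weight \<zeta> f"
  let ?a = "\<lambda>T. \<Prod>t\<in>T. f (x - t) - 1"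
  have fin: "finite ?V" using assms(1) by simp
  have split: "(\<Prod>v\<in>V. f (x - v)) = (\<Prod>y\<in>Y. f (x - y)) * (\<Sum>T\<in>Pow (V - Y). ?a T)" if "V \<in> ?V" for V
  proof -
    have V: "finite V" "Y \<subseteq> V" using that assms(1) by (auto dest: finite_subset)
    have "(\<Prod>v\<in>V. f (x - v)) = (\<Prod>v\<in>V - Y. f (x - v)) * (\<Prod>y\<in>Y. f (x - y))"
      by (rule prod.subset_diff[OF V(2,1)])
    also have "(\<Prod>v\<in>V - Y. f (x - v)) = (\<Sum>T\<in>Pow (V - Y). ?a T)"
      using sum_Pow_prod[of "V - Y" "\<lambda>v. f (x - v) - 1"] V(1) by simp
    finally show ?thesis by simp
  qed
  have "gibbs_sum \<Lambda> \<zeta> f (insert x Y) = (\<Sum>V\<in>?V. \<zeta> x * (\<Prod>v\<in>V. f (x - v)) * ?w V)"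
    using assms by (intro gibbs_sum_insert) auto
  also have "\<dots> = (\<Sum>V\<in>?V. \<zeta> x * (\<Prod>y\<in>Y. f (x - y)) * (\<Sum>T\<in>Pow (V - Y). ?a T * ?w V))"
    by (intro sum.cong refl) (simp add: split sum_distrib_left[symmetric] sum_distrib_right[symmetric] mult_ac)
  also have "\<dots> = \<zeta> x * (\<Prod>y\<in>Y. f (x - y)) * (\<Sum>V\<in>?V. \<Sum>T\<in>Pow (V - Y). ?a T * ?w V)"
    by (simp add: sum_distrib_left)
  also have "(\<Sum>V\<in>?V. \<Sum>T\<in>Pow (V - Y). ?a T * ?w V)
      = (\<Sum>V\<in>?V. \<Sum>T | T \<in> Pow (\<Lambda> - Y) \<and> T \<subseteq> V. ?a T * ?w V)"
    by (intro sum.cong refl) auto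
  also have "\<dots> = (\<Sum>T\<in>Pow (\<Lambda> - Y). \<Sum>V | V \<in> ?V \<and> T \<subseteq> V. ?a T * ?w V)"
    using fin assms(1) by (intro sum.swap_restrict) auto
  also have "\<dots> = (\<Sum>T\<in>Pow (\<Lambda> - Y). ?a T * gibbs_sum \<Lambda> \<zeta> f (Y \<union> T))"
    unfolding gibbs_sum_def sum_distrib_left by (intro sum.cong refl) auto
  finally show ?thesis .
qed

lemma activity_weight_nonneg: "(\<And>x. 0 \<le> \<zeta> x) \<Longrightarrow> 0 \<le> activity_weight \<zeta> f U"
  unfolding activity_weight_def by (intro mult_nonneg_nonneg prod_nonneg pair_weight_nonneg) auto

lemma gibbs_sum_nonneg: "(\<And>x. 0 \<le> \<zeta> x) \<Longrightarrow> 0 \<le> gibbs_sum \<Lambda> \<zeta> f S"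
  unfolding gibbs_sum_def by (intro sum_nonneg activity_weight_nonneg)

lemma gibbs_sum_empty_pos:
  assumes "finite \<Lambda>" "\<And>x. 0 \<le> \<zeta> x"
  shows "0 < gibbs_sum \<Lambda> \<zeta> f {}"
proof -
  have "activity_weight \<zeta> f {} \<le> gibbs_sum \<Lambda> \<zeta> f {}"
    unfolding gibbs_sum_def
    using assms by (intro member_le_sum activity_weight_nonneg) auto
  then show ?thesis by (simp add: activity_weight_def pair_weight_def)
qed

text \<open>One more prescribed particle costs at most a factor \<open>C\<close>, whatever the
  volume. This is the source of a priori bounds uniform in the box.\<close>

lemma gibbs_sum_insert_le:
  assumes "finite \<Lambda>" "\<And>x. 0 \<le> \<zeta> x" "x \<notin> Y"
    and C: "0 \<le> C" "\<And>U. finite U \<Longrightarrow> \<zeta> x * (\<Prod>u\<in>U. f (x - u)) \<le> C"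
  shows "gibbs_sum \<Lambda> \<zeta> f (insert x Y) \<le> C * gibbs_sum \<Lambda> \<zeta> f Y"
proof (cases "x \<in> \<Lambda>")
  case True
  have "gibbs_sum \<Lambda> \<zeta> f (insert x Y)
      = (\<Sum>V | Y \<subseteq> V \<and> V \<subseteq> \<Lambda>. \<zeta> x * (\<Prod>v\<in>V. f (x - v)) * activity_weight \<zeta> f V)"
    by (rule gibbs_sum_insert[OF assms(1) True assms(3)])
  also have "\<dots> \<le> (\<Sum>V | Y \<subseteq> V \<and> V \<subseteq> \<Lambda>. C * activity_weight \<zeta> f V)"
    using assms(1) by (intro sum_mono mult_right_mono C activity_weight_nonneg assms)
      (auto dest: finite_subset)
  finally show ?thesis by (simp add: gibbs_sum_def sum_distrib_left)
next
  case False
  then show ?thesis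
    using gibbs_sum_outside[of "insert x Y" \<Lambda>] gibbs_sum_nonneg[OF assms(2)] C by simp
qed

text \<open>A particle fixed at \<open>x\<close> acts on the others as an external field, so
  conditioning on it is only a change of activity. This is where the systems indexed by
  \<open>Some x\<close> come from.\<close>

lemma gibbs_sum_palm:
  assumes "finite \<Lambda>" "x \<in> \<Lambda>" "x \<notin> S"
  shows "gibbs_sum \<Lambda> (\<lambda>_. z) f (insert x S) = z * gibbs_sum \<Lambda> (\<lambda>u. z * f (u - x)) f S"
  unfolding gibbs_sum_insert[OF assms] gibbs_sum_def[of \<Lambda> "\<lambda>u. z * f (u - x)"] activity_weight_def
  by (simp add: sum_distrib_left prod.distrib mult_ac f_commute[of x])

end

text \<open>Dominated convergence in quantitative form. The index from which the bound with
  \<open>e\<close> holds depends on \<open>T\<close>, so a finite \<open>G\<close> carrying all but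
  \<eta> / C' of the mass of \<open>B\<close> is treated term by term, and the tail is left to the
  uniform bound.\<close>

lemma eventually_abs_infsum_le:
  fixes v :: "nat \<Rightarrow> 'a \<Rightarrow> real" and B :: "'a \<Rightarrow> real"
  assumes B: "B summable_on P" "\<And>T. T \<in> P \<Longrightarrow> 0 \<le> B T"
    and e: "0 < e" "0 < \<eta>"
    and bd: "\<And>k T. T \<in> P \<Longrightarrow> \<bar>v k T\<bar> \<le> C * B T"
    and ev: "\<And>T. T \<in> P \<Longrightarrow> \<forall>\<^sub>F k in sequentially. \<bar>v k T\<bar> \<le> e * B T"
  shows "\<forall>\<^sub>F k in sequentially. \<bar>\<Sum>\<^sub>\<infinity>T\<in>P. v k T\<bar> \<le> e * (\<Sum>\<^sub>\<infinity>T\<in>P. B T) + \<eta>"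
proof -
  define C' where "C' = max C 1"
  have bd': "\<bar>v k T\<bar> \<le> C' * B T" if "T \<in> P" for k T
    using bd[OF that, of k] mult_right_mono[OF max.cobounded1[of C 1] B(2)[OF that]]
    unfolding C'_def by simp
  have C': "0 < C'" unfolding C'_def by simp
  then obtain G where G: "finite G" "G \<subseteq> P" "dist (sum B G) (infsum B P) \<le> \<eta> / C'"
    using infsum_finite_approximation[OF B(1), of "\<eta> / C'"] e by auto
  have BG: "B summable_on (P - G)" using B(1) by (rule summable_on_subset) auto
  have tail: "infsum B (P - G) \<le> \<eta> / C'"
    using infsum_Diff[OF B(1) summable_on_finite[OF G(1)] G(2)] G(1,3) by (simp add: dist_real_def)
  have part: "sum B G \<le> infsum B P"
    using B G by (intro finite_sum_le_infsum) auto
  have "\<forall>\<^sub>F k in sequentially. \<forall>T\<in>G. \<bar>v k T\<bar> \<le> e * B T"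
    using G by (intro eventually_ball_finite) (auto intro!: ev)
  then show ?thesis
  proof eventually_elim
    case (elim k)
    have CB: "(\<lambda>T. C' * B T) summable_on P" using B(1) by (rule summable_on_cmult_right)
    have vs: "(\<lambda>T. \<bar>v k T\<bar>) summable_on P"
      using Infinite_Sum.abs_summable_on_comparison_test'[OF CB, of "v k"] bd' by simp
    have vP: "v k summable_on P" by (rule abs_summable_summable) (use vs in simp)
    have vD: "v k summable_on (P - G)" using vP by (rule summable_on_subset) auto
    have "infsum (v k) P = sum (v k) G + infsum (v k) (P - G)"
      using infsum_Diff[OF vP summable_on_finite[OF G(1)] G(2)] G(1) by simp
    moreover have "\<bar>sum (v k) G\<bar> \<le> e * sum B G"
      unfolding sum_distrib_left by (rule order_trans[OF sum_abs sum_mono]) (use elim in auto)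
    moreover have "\<bar>infsum (v k) (P - G)\<bar> \<le> C' * infsum B (P - G)"
      using norm_infsum_le[OF has_sum_infsum[OF vD] has_sum_cmult_right[OF has_sum_infsum[OF BG], of C']]
        bd' by simp
    moreover have "C' * infsum B (P - G) \<le> \<eta>" using tail C' by (simp add: field_simps)
    moreover have "e * sum B G \<le> e * infsum B P" using part e(1) by simp
    ultimately show ?case by linarith
  qed
qed

section \<open>The infinite-volume limit of the Kirkwood-Salsburg equations\<close>

locale inverse_solution = inverse_problem h r \<rho> \<xi> \<delta>
  for h :: "'v::ab_group_add \<Rightarrow> real" and r \<rho> \<xi> \<delta> :: real +
  fixes \<sigma> :: "'v option \<Rightarrow> 'v set \<Rightarrow> real" and g :: "'v \<Rightarrow> real" and z :: real
  assumes adm: "admissible \<sigma> g"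
    and corr_fixed: "\<And>i S. finite S \<Longrightarrow> ks_corr \<rho> g \<sigma> i S = \<sigma> i S"
    and mayer_fixed: "\<And>x. ks_mayer h \<rho> g \<sigma> x = g x"
    and h_ge: "\<And>x. x \<noteq> 0 \<Longrightarrow> - r \<le> h x" and h_zero: "h 0 = - 1"
    and z_def: "z = \<rho> / ks_sum \<rho> g (\<sigma> None) 0 {}"
begin

sublocale ks_pair "1 / 2" \<xi> \<rho> \<delta> "\<lambda>_. g" "\<lambda>_. \<sigma>"
  by (rule admissible_ks_pair[OF adm])

lemma z_pos: "0 < z"
  unfolding z_def using \<rho> ks_sum_pos by simp

lemma mayer_zero: "g 0 = - 1"
  using mayer_fixed[of 0] h_zero by (simp add: ks_mayer_def)

text \<open>The admissible deviation (1 - r)/2 uses up half of the gap between - r and -1.\<close>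

lemma mayer_ge: "x \<noteq> 0 \<Longrightarrow> - ((1 + r) / 2) \<le> g x"
proof -
  assume "x \<noteq> 0"
  then have "- r \<le> h x" by (rule h_ge)
  moreover have "\<bar>g x - h x\<bar> \<le> (1 - r) / 2" using admissibleD(4)[OF adm, of "{x}"] by simp
  then have "- (g x - h x) \<le> (1 - r) / 2" by (rule order_trans[OF abs_ge_minus_self])
  ultimately show "- ((1 + r) / 2) \<le> g x" by argo
qed

sublocale even_weight "\<lambda>x. 1 + g x"
proof
  show "0 \<le> 1 + g x" for x
  proof (cases "x = 0")
    case False
    have "(1 + r) / 2 < 1" using r by simp
    then show ?thesis using mayer_ge[OF False] by linarith
  qed (simp add: mayer_zero)
qed (use admissibleD(5)[OF adm] mayer_zero in auto)

abbreviation "activity i \<equiv> \<lambda>x. z * palm_weight g i x"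

text \<open>The finite-volume counterpart of \<sigma>, with the same scaling. It is 0, not
  undefined, on sets that leave the volume and can therefore be inserted into the infinite sums
  \<open>ks_sum\<close>.\<close>

definition box_corr :: "'v set \<Rightarrow> 'v option \<Rightarrow> 'v set \<Rightarrow> real" where
  "box_corr \<Lambda> i S = gibbs_sum \<Lambda> (activity i) (\<lambda>x. 1 + g x) S /
     (gibbs_sum \<Lambda> (activity i) (\<lambda>x. 1 + g x) {} * \<rho> ^ card S)"

lemma activity_nonneg: "0 \<le> activity i x"
  using z_pos f_nonneg by (cases i) (auto simp: palm_weight_def)

lemma palm_prod_le:
  assumes "finite U"
  shows "palm_weight g i x * (\<Prod>u\<in>U. 1 + g (x - u)) \<le> exp 6"
    and "0 \<le> palm_weight g i x * (\<Prod>u\<in>U. 1 + g (x - u))"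
proof -
  have nn: "0 \<le> palm_weight g i x" "0 \<le> (\<Prod>u\<in>U. 1 + g (x - u))"
    using f_nonneg by (auto simp: palm_weight_def prod_nonneg split: option.split)
  then show "0 \<le> palm_weight g i x * (\<Prod>u\<in>U. 1 + g (x - u))" by simp
  have "palm_weight g i x * (\<Prod>u\<in>U. 1 + g (x - u)) \<le> exp 3 * exp 3"
    using palm_weight_bound[of i x] mayer_prod_bound[OF assms, of x] nn
    by (intro mult_mono) auto
  then show "palm_weight g i x * (\<Prod>u\<in>U. 1 + g (x - u)) \<le> exp 6" by (simp flip: exp_add)
qed

lemma z_le: "z \<le> 2 * \<rho>"
proof -
  have "1 / ks_sum \<rho> g (\<sigma> None) 0 {} \<le> 2"
    using ks_sum_inverse_le[of None 0] ks_sum_pos[of None 0] by simp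
  then show ?thesis unfolding z_def using mult_left_mono[of _ 2 \<rho>] \<rho> by fastforce
qed

lemma gibbs_sum_activity_pos: "finite \<Lambda> \<Longrightarrow> 0 < gibbs_sum \<Lambda> (activity i) (\<lambda>x. 1 + g x) {}"
  by (intro gibbs_sum_empty_pos activity_nonneg)

lemma box_corr_nonneg: "finite \<Lambda> \<Longrightarrow> 0 \<le> box_corr \<Lambda> i S"
  unfolding box_corr_def
  using \<rho> by (intro divide_nonneg_nonneg mult_nonneg_nonneg gibbs_sum_nonneg activity_nonneg) auto

lemma box_corr_empty: "finite \<Lambda> \<Longrightarrow> box_corr \<Lambda> i {} = 1"
  unfolding box_corr_def using gibbs_sum_activity_pos[of \<Lambda> i] by simp

text \<open>Each particle costs at most z exp 6 \<le> 2 \<rho> exp 6 \<le> \<rho> \<xi>,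
  independently of the volume. This provides the domination in the limit.\<close>

lemma box_corr_le:
  assumes "finite \<Lambda>" "finite S"
  shows "box_corr \<Lambda> i S \<le> \<xi> ^ card S"
  using assms(2)
proof (induction S rule: finite_induct)
  case empty
  then show ?case using box_corr_empty[OF assms(1)] by simp
next
  case (insert x S)
  let ?N = "gibbs_sum \<Lambda> (activity i) (\<lambda>x. 1 + g x)"
  have pos: "0 < ?N {} * \<rho> ^ card S" "0 < ?N {} * \<rho> ^ card (insert x S)"
    using gibbs_sum_activity_pos[OF assms(1), of i] \<rho> by auto
  have two_exp: "2 * exp 6 \<le> \<xi>" using \<xi> exp_gt_zero[of "6::real"] by linarith
  have "?N (insert x S) \<le> (2 * \<rho> * exp 6) * ?N S"
  proof (rule gibbs_sum_insert_le[OF assms(1) activity_nonneg insert(2)])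
    fix U :: "'v set" assume U: "finite U"
    show "activity i x * (\<Prod>u\<in>U. 1 + g (x - u)) \<le> 2 * \<rho> * exp 6"
      unfolding mult.assoc[of z]
      using z_le z_pos \<rho> palm_prod_le[OF U, of i x] by (intro mult_mono) auto
  qed (use \<rho> in auto)
  also have "\<dots> \<le> (\<rho> * \<xi>) * ?N S"
    using two_exp \<rho> by (intro mult_right_mono gibbs_sum_nonneg activity_nonneg) auto
  also have "?N S = box_corr \<Lambda> i S * (?N {} * \<rho> ^ card S)"
    using iffD1[OF nonzero_eq_divide_eq[OF less_imp_neq[OF pos(1), symmetric]] box_corr_def] by simp
  also have "(\<rho> * \<xi>) * \<dots> \<le> (\<rho> * \<xi>) * (\<xi> ^ card S * (?N {} * \<rho> ^ card S))"
    using insert pos \<rho> \<xi>_pos by (intro mult_left_mono mult_right_mono) auto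
  also have "\<dots> = \<xi> ^ card (insert x S) * (?N {} * \<rho> ^ card (insert x S))"
    using insert by simp
  finally show ?case unfolding box_corr_def using pos(2) by (simp add: divide_le_eq)
qed

text \<open>Clusters leaving the volume contribute 0, so the infinite sum is the finite one, and the
  choice of \<open>z\<close> produces exactly the normalising quotient of the limiting equations.
  Boundary effects remain only for sets that are not inside the volume.\<close>

lemma box_corr_kirkwood_salsburg:
  assumes "finite \<Lambda>" "insert x Y \<subseteq> \<Lambda>" "x \<notin> Y"
  shows "box_corr \<Lambda> i (insert x Y) = palm_weight g i x * (\<Prod>y\<in>Y. 1 + g (x - y)) *
    ks_sum \<rho> g (box_corr \<Lambda> i) x Y * (1 / ks_sum \<rho> g (\<sigma> None) 0 {})"
proof -
  let ?N = "gibbs_sum \<Lambda> (activity i) (\<lambda>x. 1 + g x)"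
  have finY: "finite Y" using assms by (auto dest: finite_subset)
  have pos: "0 < ?N {}" using gibbs_sum_activity_pos[OF assms(1)] .
  have "ks_sum \<rho> g (box_corr \<Lambda> i) x Y
      = (\<Sum>\<^sub>\<infinity>T\<in>Pow (\<Lambda> - Y). (\<Prod>t\<in>T. \<rho> * g (x - t)) * box_corr \<Lambda> i (Y \<union> T))"
    unfolding ks_sum_def
  proof (rule infsum_cong_neutral)
    fix T assume "T \<in> {T. finite T \<and> T \<inter> Y = {}} - Pow (\<Lambda> - Y)"
    then have "\<not> Y \<union> T \<subseteq> \<Lambda>" by auto
    then show "(\<Prod>t\<in>T. \<rho> * g (x - t)) * box_corr \<Lambda> i (Y \<union> T) = 0"
      by (simp add: box_corr_def gibbs_sum_outside)
  qed (use assms(1) in \<open>auto dest: finite_subset\<close>)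
  also have "\<dots> = (\<Sum>T\<in>Pow (\<Lambda> - Y). (\<Prod>t\<in>T. \<rho> * g (x - t)) * box_corr \<Lambda> i (Y \<union> T))"
    using assms(1) by simp
  also have "\<dots> = (\<Sum>T\<in>Pow (\<Lambda> - Y). (\<Prod>t\<in>T. g (x - t)) * ?N (Y \<union> T) * (1 / (?N {} * \<rho> ^ card Y)))"
  proof (rule sum.cong[OF refl])
    fix T assume "T \<in> Pow (\<Lambda> - Y)"
    then have "card (Y \<union> T) = card Y + card T"
      using assms(1) finY by (intro card_Un_disjoint) (auto dest: finite_subset)
    then show "(\<Prod>t\<in>T. \<rho> * g (x - t)) * box_corr \<Lambda> i (Y \<union> T)
        = (\<Prod>t\<in>T. g (x - t)) * ?N (Y \<union> T) * (1 / (?N {} * \<rho> ^ card Y))"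
      using \<rho> by (simp add: box_corr_def prod.distrib power_add)
  qed
  also have "\<dots> = (\<Sum>T\<in>Pow (\<Lambda> - Y). (\<Prod>t\<in>T. g (x - t)) * ?N (Y \<union> T)) * (1 / (?N {} * \<rho> ^ card Y))"
    by (rule sum_distrib_right[symmetric])
  finally have eq: "ks_sum \<rho> g (box_corr \<Lambda> i) x Y
      = (\<Sum>T\<in>Pow (\<Lambda> - Y). (\<Prod>t\<in>T. g (x - t)) * ?N (Y \<union> T)) * (1 / (?N {} * \<rho> ^ card Y))" .
  have "?N (insert x Y) = activity i x * (\<Prod>y\<in>Y. 1 + g (x - y)) *
      (\<Sum>T\<in>Pow (\<Lambda> - Y). (\<Prod>t\<in>T. g (x - t)) * ?N (Y \<union> T))"
    using gibbs_sum_kirkwood_salsburg[OF assms, of "activity i"] by simp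
  moreover have "card (insert x Y) = Suc (card Y)" using finY assms(3) by simp
  ultimately show ?thesis
    unfolding eq box_corr_def using \<rho> pos ks_sum_pos[of None 0] by (simp add: z_def mult_ac)
qed

context
  fixes \<Lambda> :: "nat \<Rightarrow> 'v set"
  assumes \<Lambda>_finite: "\<And>k. finite (\<Lambda> k)"
    and \<Lambda>_exhausts: "\<And>S. finite S \<Longrightarrow> \<forall>\<^sub>F k in sequentially. S \<subseteq> \<Lambda> k"
begin

text \<open>The 5/2 is 3/2, a bound for the exponential over clusters, plus 1 for the tail, which is
  allowed the error \<open>e * \<xi> ^ card Y\<close>.\<close>

lemma ks_sum_box_corr_close:
  assumes e: "0 < e" "\<And>S. finite S \<Longrightarrow> \<forall>\<^sub>F k in sequentially.
      \<bar>box_corr (\<Lambda> k) i S - \<sigma> i S\<bar> \<le> e * \<xi> ^ card S"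
    and Y: "finite Y"
  shows "\<forall>\<^sub>F k in sequentially.
    \<bar>ks_sum \<rho> g (box_corr (\<Lambda> k) i) x Y - ks_sum \<rho> g (\<sigma> i) x Y\<bar> \<le> 5 / 2 * e * \<xi> ^ card Y"
proof -
  let ?P = "{T. finite T \<and> T \<inter> Y = {}}"
  let ?v = "\<lambda>k T. (\<Prod>t\<in>T. \<rho> * g (x - t)) * (box_corr (\<Lambda> k) i (Y \<union> T) - \<sigma> i (Y \<union> T))"
  define q where "q t = \<xi> * \<bar>\<rho> * g (x - t)\<bar>" for t
  define B where "B T = \<xi> ^ card Y * (\<Prod>t\<in>T. q t)" for T
  have q0: "0 \<le> q t" for t unfolding q_def using \<xi>_pos by simp
  have qs: "(\<Sum>t\<in>F. q t) \<le> \<xi> * (3 * \<rho>)" if "finite F" for F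
    unfolding q_def sum_distrib_left[symmetric]
    using activity_sum[OF that, of x] \<xi>_pos by (intro mult_left_mono) auto
  have P: "?P \<subseteq> {T. finite T}" by auto
  have Bs: "B summable_on ?P"
    unfolding B_def by (intro summable_on_cmult_right set_prod_summable[OF q0 qs P])
  have B0: "0 \<le> B T" for T unfolding B_def using q0 \<xi>_pos by (simp add: prod_nonneg)
  have B_eq: "\<bar>\<Prod>t\<in>T. \<rho> * g (x - t)\<bar> * \<xi> ^ card (Y \<union> T) = B T" if "T \<in> ?P" for T
  proof -
    have "card (Y \<union> T) = card Y + card T" using that Y by (intro card_Un_disjoint) auto
    then show ?thesis
      unfolding B_def q_def using \<rho> by (simp add: power_add prod.distrib abs_prod abs_mult mult_ac)
  qed
  have v_le: "\<bar>?v k T\<bar> \<le> c * B T"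
    if "T \<in> ?P" "\<bar>box_corr (\<Lambda> k) i (Y \<union> T) - \<sigma> i (Y \<union> T)\<bar> \<le> c * \<xi> ^ card (Y \<union> T)" for k T c
    using mult_left_mono[OF that(2), of "\<bar>\<Prod>t\<in>T. \<rho> * g (x - t)\<bar>"] B_eq[OF that(1)]
    by (simp add: abs_mult mult_ac)
  have bd: "\<bar>box_corr (\<Lambda> k) i S - \<sigma> i S\<bar> \<le> 2 * \<xi> ^ card S" if "finite S" for k S
    using box_corr_le[OF \<Lambda>_finite that, of k i] box_corr_nonneg[OF \<Lambda>_finite, of k i S]
      corr_bound[OF that, of i]
    by simp
  have ev: "\<forall>\<^sub>F k in sequentially. \<bar>infsum (?v k) ?P\<bar> \<le> e * infsum B ?P + e * \<xi> ^ card Y"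
  proof (rule eventually_abs_infsum_le[OF Bs B0, where C = 2])
    fix T assume T: "T \<in> ?P"
    then have fin: "finite (Y \<union> T)" using Y by simp
    show "\<bar>?v k T\<bar> \<le> 2 * B T" for k by (rule v_le[OF T bd[OF fin]])
    show "\<forall>\<^sub>F k in sequentially. \<bar>?v k T\<bar> \<le> e * B T"
      by (rule eventually_mono[OF e(2)[OF fin]]) (rule v_le[OF T])
  qed (use e \<xi>_pos in auto)
  have "infsum B ?P \<le> \<xi> ^ card Y * (3 / 2)"
    unfolding B_def infsum_cmult_right'
    using infsum_set_prod_le_exp[OF q0 qs P] exp_le \<delta> r \<xi>_pos by (intro mult_left_mono) auto
  then have le: "e * infsum B ?P + e * \<xi> ^ card Y \<le> 5 / 2 * e * \<xi> ^ card Y"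
    using mult_left_mono[of "infsum B ?P" "\<xi> ^ card Y * (3 / 2)" e] e(1) by simp
  have diff: "ks_sum \<rho> g (box_corr (\<Lambda> k) i) x Y - ks_sum \<rho> g (\<sigma> i) x Y = infsum (?v k) ?P" for k
    unfolding ks_sum_def right_diff_distrib
  proof (rule infsum_diff[symmetric])
    show "(\<lambda>T. (\<Prod>t\<in>T. \<rho> * g (x - t)) * \<sigma> i (Y \<union> T)) summable_on ?P"
      by (rule ks_summable[OF Y])
    have "\<bar>(\<Prod>t\<in>T. \<rho> * g (x - t)) * box_corr (\<Lambda> k) i (Y \<union> T)\<bar> \<le> B T" if "T \<in> ?P" for T
    proof -
      have "\<bar>box_corr (\<Lambda> k) i (Y \<union> T)\<bar> \<le> \<xi> ^ card (Y \<union> T)"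
        using box_corr_le[OF \<Lambda>_finite, of "Y \<union> T" k i] box_corr_nonneg[OF \<Lambda>_finite, of k i "Y \<union> T"]
          that Y by simp
      then show ?thesis
        using mult_left_mono[of _ "\<xi> ^ card (Y \<union> T)" "\<bar>\<Prod>t\<in>T. \<rho> * g (x - t)\<bar>"] B_eq[OF that]
        by (simp add: abs_mult)
    qed
    then have "(\<lambda>T. norm ((\<Prod>t\<in>T. \<rho> * g (x - t)) * box_corr (\<Lambda> k) i (Y \<union> T))) summable_on ?P"
      by (intro Infinite_Sum.abs_summable_on_comparison_test'[OF Bs]) simp
    then show "(\<lambda>T. (\<Prod>t\<in>T. \<rho> * g (x - t)) * box_corr (\<Lambda> k) i (Y \<union> T)) summable_on ?P"
      by (rule abs_summable_summable)
  qed
  show ?thesis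
    by (rule eventually_mono[OF ev]) (unfold diff, rule order_trans[OF _ le])
qed

text \<open>What contracts is the supremum over \<open>S\<close> of the limit superior in
  \<open>k\<close> of the weighted error: the index may depend on \<open>S\<close>, the factor
  \<open>e\<close> may not. Thus for each \<open>S\<close> it suffices to wait until the volume
  contains it.\<close>

lemma box_corr_close_step:
  assumes e: "0 < e" "\<And>S. finite S \<Longrightarrow> \<forall>\<^sub>F k in sequentially.
      \<bar>box_corr (\<Lambda> k) i S - \<sigma> i S\<bar> \<le> e * \<xi> ^ card S"
    and S: "finite S"
  shows "\<forall>\<^sub>F k in sequentially. \<bar>box_corr (\<Lambda> k) i S - \<sigma> i S\<bar> \<le> e / 2 * \<xi> ^ card S"
proof (cases "S = {}")
  case True
  then show ?thesis using e(1) by (simp add: box_corr_empty[OF \<Lambda>_finite] corr_empty)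
next
  case False
  let ?Q = "\<lambda>s x. ks_sum \<rho> g s x (S - {x})"
  let ?w = "\<lambda>x. palm_weight g i x * (\<Prod>y\<in>S - {x}. 1 + g (x - y)) * (1 / ks_sum \<rho> g (\<sigma> None) 0 {})"
  have "\<forall>\<^sub>F k in sequentially. S \<subseteq> \<Lambda> k" by (rule \<Lambda>_exhausts[OF S])
  moreover have "\<forall>\<^sub>F k in sequentially. \<forall>x\<in>S.
      \<bar>?Q (box_corr (\<Lambda> k) i) x - ?Q (\<sigma> i) x\<bar> \<le> 5 / 2 * e * \<xi> ^ card (S - {x})"
  proof (rule eventually_ball_finite[OF S], rule ballI)
    fix x
    show "\<forall>\<^sub>F k in sequentially.
        \<bar>?Q (box_corr (\<Lambda> k) i) x - ?Q (\<sigma> i) x\<bar> \<le> 5 / 2 * e * \<xi> ^ card (S - {x})"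
      by (rule ks_sum_box_corr_close[OF e]) (use S in simp_all)
  qed
  ultimately show ?thesis
  proof eventually_elim
    case (elim k)
    have \<sigma>_eq: "\<sigma> i S = (\<Sum>x\<in>S. 1 / real (card S) * (?w x * ?Q (\<sigma> i) x))"
      using corr_fixed[OF S, of i] False by (simp add: ks_corr_def ks_rhs_def mult_ac)
    have box: "box_corr (\<Lambda> k) i S = ?w x * ?Q (box_corr (\<Lambda> k) i) x" if "x \<in> S" for x
    proof -
      have eq: "insert x (S - {x}) = S" using that by auto
      have "box_corr (\<Lambda> k) i (insert x (S - {x})) = palm_weight g i x *
          (\<Prod>y\<in>S - {x}. 1 + g (x - y)) * ?Q (box_corr (\<Lambda> k) i) x *
          (1 / ks_sum \<rho> g (\<sigma> None) 0 {})"
        by (rule box_corr_kirkwood_salsburg[OF \<Lambda>_finite]) (use elim(1) eq in auto)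
      then show ?thesis unfolding eq by (simp only: mult_ac)
    qed
    \<comment> \<open>\<sigma> solves only the averaged equation, whereas \<open>box_corr\<close>
      solves the one for every removed \<open>x\<close>; writing it as an average of itself matches
      the two.\<close>
    have "box_corr (\<Lambda> k) i S = (\<Sum>x\<in>S. 1 / real (card S) * box_corr (\<Lambda> k) i S)"
      using S False by simp
    also have "\<dots> = (\<Sum>x\<in>S. 1 / real (card S) * (?w x * ?Q (box_corr (\<Lambda> k) i) x))"
      by (rule sum.cong[OF refl]) (rule arg_cong2[where f = "(*)", OF refl box])
    finally have diff: "box_corr (\<Lambda> k) i S - \<sigma> i S
        = (\<Sum>x\<in>S. 1 / real (card S) * (?w x * (?Q (box_corr (\<Lambda> k) i) x - ?Q (\<sigma> i) x)))"
      unfolding \<sigma>_eq by (simp add: right_diff_distrib sum_subtractf)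
    have "\<bar>box_corr (\<Lambda> k) i S - \<sigma> i S\<bar> \<le> (\<Sum>x\<in>S. 1 / real (card S) * (e / 2 * \<xi> ^ card S))"
      unfolding diff
    proof (rule order_trans[OF sum_abs sum_mono])
      fix x assume x: "x \<in> S"
      have exp_le_\<xi>: "exp 6 * 2 \<le> \<xi> / 5" using \<xi> exp_gt_zero[of "6::real"] by argo
      have pow: "\<xi> ^ card S = \<xi> * \<xi> ^ card (S - {x})"
        by (simp only: power_Suc[symmetric] card_Suc_Diff1[OF S x])
      let ?d = "?Q (box_corr (\<Lambda> k) i) x - ?Q (\<sigma> i) x"
      have inv: "0 < 1 / ks_sum \<rho> g (\<sigma> None) 0 {}" "1 / ks_sum \<rho> g (\<sigma> None) 0 {} \<le> 2"
        using ks_sum_pos[of None 0] ks_sum_inverse_le[of None 0] by auto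
      have w: "0 \<le> ?w x" "?w x \<le> exp 6 * 2"
        using inv S by (intro mult_mono mult_nonneg_nonneg palm_prod_le; simp)+
      have "\<bar>?w x * ?d\<bar> \<le> (exp 6 * 2) * (5 / 2 * e * \<xi> ^ card (S - {x}))"
        unfolding abs_mult[of "?w x"] using w elim x by (intro mult_mono) auto
      also have "\<dots> \<le> (\<xi> / 5) * (5 / 2 * e * \<xi> ^ card (S - {x}))"
        using exp_le_\<xi> e(1) \<xi>_pos by (intro mult_right_mono) simp_all
      also have "\<dots> = e / 2 * \<xi> ^ card S"
        unfolding pow by (simp del: card_Diff_singleton card_Diff_insert)
      finally have le: "\<bar>?w x * ?d\<bar> \<le> e / 2 * \<xi> ^ card S" .
      have "\<bar>1 / real (card S) * (?w x * ?d)\<bar> = 1 / real (card S) * \<bar>?w x * ?d\<bar>"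
        by (simp only: abs_mult[of "1 / real (card S)"] abs_of_nonneg zero_le_divide_1_iff of_nat_0_le_iff)
      also have "\<dots> \<le> 1 / real (card S) * (e / 2 * \<xi> ^ card S)"
        by (rule mult_left_mono[OF le]) simp
      finally show "\<bar>1 / real (card S) * (?w x * ?d)\<bar> \<le> 1 / real (card S) * (e / 2 * \<xi> ^ card S)" .
    qed
    also have "\<dots> = e / 2 * \<xi> ^ card S" using S False by simp
    finally show ?case .
  qed
qed

lemma box_corr_tendsto:
  assumes "finite S"
  shows "(\<lambda>k. box_corr (\<Lambda> k) i S) \<longlonglongrightarrow> \<sigma> i S"
proof -
  have close: "\<forall>\<^sub>F k in sequentially. \<bar>box_corr (\<Lambda> k) i S - \<sigma> i S\<bar> \<le> 2 / 2 ^ n * \<xi> ^ card S"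
    if "finite S" for S n
    using that
  proof (induction n arbitrary: S)
    case 0
    have "\<bar>box_corr (\<Lambda> k) i S - \<sigma> i S\<bar> \<le> 2 * \<xi> ^ card S" for k
      using box_corr_le[OF \<Lambda>_finite 0, of k i] box_corr_nonneg[OF \<Lambda>_finite, of k i S]
        corr_bound[OF 0, of i]
      by simp
    then show ?case by simp
  next
    case (Suc n)
    then show ?case using box_corr_close_step[of "2 / 2 ^ n" i S] by (simp add: field_simps)
  qed
  show ?thesis
  proof (rule tendstoI)
    fix e :: real assume e: "0 < e"
    have "(\<lambda>n. 2 / 2 ^ n * \<xi> ^ card S) \<longlonglongrightarrow> 0" by real_asymp
    then have "\<forall>\<^sub>F n in sequentially. 2 / 2 ^ n * \<xi> ^ card S < e"
      using e by (rule order_tendstoD)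
    then obtain n where "2 / 2 ^ n * \<xi> ^ card S < e"
      by (auto simp: eventually_sequentially)
    with close[OF assms, of n] show "\<forall>\<^sub>F k in sequentially. dist (box_corr (\<Lambda> k) i S) (\<sigma> i S) < e"
      by (auto elim!: eventually_mono simp: dist_real_def)
  qed
qed

end

text \<open>The normalising quotient is taken at the origin; translation invariance carries it to
  \<open>x\<close>, where it cancels the sum.\<close>

lemma corr_singleton: "\<sigma> None {x} = 1"
proof -
  have sym: "lattice_symmetry (\<lambda>y. y + x)" by (auto simp: lattice_symmetry_def)
  have "ks_sum \<rho> g (\<sigma> None) (0 + x) ((\<lambda>y. y + x) ` {}) = ks_sum \<rho> g (\<sigma> None) 0 {}"
    using admissibleD(6)[OF adm sym, of _ None] admissibleD(5)[OF adm]
    by (intro ks_sum_symmetry[OF sym]) auto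
  then show ?thesis
    using corr_fixed[of "{x}" None] ks_sum_pos[of None 0]
    by (simp add: ks_corr_def ks_rhs_def palm_weight_def)
qed

text \<open>The equation for \<open>g\<close> is posed at the origin with conditioning point y - x.
  A translation by \<open>y\<close> and the reflection bring the present sum to that form; then all
  sums cancel and the prescribed 1 + h is left.\<close>

lemma corr_palm_singleton: "\<sigma> (Some x) {y} = 1 + h (y - x)"
proof -
  have sym1: "lattice_symmetry (\<lambda>v. v + y)" and sym2: "lattice_symmetry (uminus :: 'v \<Rightarrow> 'v)"
    by (auto simp: lattice_symmetry_def)
  have "ks_sum \<rho> g (\<sigma> (Some x)) (0 + y) ((\<lambda>v. v + y) ` {}) = ks_sum \<rho> g (\<sigma> (Some (x - y))) 0 {}"
    using admissibleD(6)[OF adm sym1, of _ "Some (x - y)"] admissibleD(5)[OF adm]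
    by (intro ks_sum_symmetry[OF sym1]) auto
  moreover have "ks_sum \<rho> g (\<sigma> (Some (x - y))) (- 0) (uminus ` {}) = ks_sum \<rho> g (\<sigma> (Some (y - x))) 0 {}"
    using admissibleD(6)[OF adm sym2, of _ "Some (y - x)"] admissibleD(5)[OF adm]
    by (intro ks_sum_symmetry[OF sym2]) auto
  ultimately have "ks_sum \<rho> g (\<sigma> (Some x)) y {} = ks_sum \<rho> g (\<sigma> (Some (y - x))) 0 {}" by simp
  moreover have "1 + g (y - x) = (1 + h (y - x)) * ks_sum \<rho> g (\<sigma> None) 0 {} *
      (1 / ks_sum \<rho> g (\<sigma> (Some (y - x))) 0 {})"
    using mayer_fixed[of "y - x"] by (simp add: ks_mayer_def)
  ultimately show ?thesis
    using corr_fixed[of "{y}" "Some x"] ks_sum_pos[of None 0] ks_sum_pos[of "Some (y - x)" 0]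
    by (simp add: ks_corr_def ks_rhs_def palm_weight_def)
qed

end

section \<open>Configurations as lists\<close>

lemma exp_minus_add:
  assumes "a \<noteq> - \<infinity>" "b \<noteq> - \<infinity>"
  shows "exp_minus (a + b) = exp_minus a * exp_minus b"
  using assms by (cases a; cases b) (auto simp: exp_minus_def mult_exp_exp)

lemma exp_minus_sum:
  assumes "\<And>a. a \<in> A \<Longrightarrow> u a \<noteq> - \<infinity>"
  shows "exp_minus (\<Sum>a\<in>A. u a) = (\<Prod>a\<in>A. exp_minus (u a))"
proof -
  \<comment> \<open>The induction is strengthened because \<open>exp_minus\<close> is multiplicative
    only as long as the partial sums avoid -\<infinity>.\<close>
  have "(\<Sum>a\<in>A. u a) \<noteq> - \<infinity> \<and> ?thesis"
    using assms
  proof (induction A rule: infinite_finite_induct)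
    case (insert x A)
    then show ?case by (auto simp: exp_minus_add)
  qed (auto simp: exp_minus_def)
  then show ?thesis ..
qed

lemma index_pairs_Cons:
  "{(i, j). i < j \<and> j < length (x # xs)} =
    (\<lambda>j. (0, Suc j)) ` {..<length xs} \<union> map_prod Suc Suc ` {(i, j). i < j \<and> j < length xs}"
proof (intro set_eqI iffI; clarsimp)
  fix i j assume ij: "i < j" "j < Suc (length xs)"
    "(i, j) \<notin> map_prod Suc Suc ` {(i, j). i < j \<and> j < length xs}"
  obtain j' where j: "j = Suc j'" using ij(1) by (cases j) auto
  show "(i, j) \<in> (\<lambda>j. (0, Suc j)) ` {..<length xs}"
  proof (cases i)
    case (Suc i')
    then have "(i, j) = map_prod Suc Suc (i', j')" "i' < j'" "j' < length xs" using ij j by auto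
    then show ?thesis using ij(3) by blast
  qed (use ij j in auto)
qed auto

text \<open>Splitting off the head particle mirrors \<open>pair_weight_insert\<close>. A repeated
  point meets the hard core, so the weight of a list depends on its set of points and is 0 if the
  list has repetitions.\<close>

lemma exp_minus_energy:
  fixes \<Phi> :: "int ^ 'd \<Rightarrow> ereal"
  assumes "\<And>x. \<Phi> x \<noteq> - \<infinity>"
  assumes "even_weight (\<lambda>x. exp_minus (\<Phi> x))"
  shows "exp_minus (energy \<Phi> xs) =
    (if distinct xs then pair_weight (\<lambda>x. exp_minus (\<Phi> x)) (set xs) else 0)"
proof -
  interpret even_weight "\<lambda>x. exp_minus (\<Phi> x)" by (rule assms(2))
  let ?f = "\<lambda>x. exp_minus (\<Phi> x)" and ?P = "\<lambda>xs. {(i, j). i < j \<and> j < length xs}"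
  have fin: "finite (?P xs)" for xs :: "(int ^ 'd) list"
    by (rule finite_subset[of _ "{..<length xs} \<times> {..<length xs}"]) auto
  have energy: "exp_minus (energy \<Phi> xs) = (\<Prod>p\<in>?P xs. ?f (xs ! fst p - xs ! snd p))" for xs
    unfolding energy_def case_prod_beta by (rule exp_minus_sum) (rule assms(1))
  have energy_Cons: "exp_minus (energy \<Phi> (x # xs)) = (\<Prod>j<length xs. ?f (x - xs ! j)) * exp_minus (energy \<Phi> xs)"
    for x xs
    unfolding energy index_pairs_Cons
    by (subst prod.union_disjoint) (auto simp: fin prod.reindex inj_on_def map_prod_def split_beta)
  show ?thesis
  proof (induction xs)
    case Nil
    then show ?case by (simp add: energy pair_weight_def)
  next
    case (Cons x xs)
    show ?case
    proof (cases "distinct (x # xs)")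
      case True
      have "(\<Prod>j<length xs. ?f (x - xs ! j)) = (\<Prod>y\<in>set xs. ?f (x - y))"
        using True by (intro prod.reindex_bij_betw bij_betw_nth) auto
      then show ?thesis using True Cons by (simp add: energy_Cons pair_weight_insert)
    next
      case False
      have "exp_minus (energy \<Phi> xs) = 0 \<or> (\<Prod>j<length xs. ?f (x - xs ! j)) = 0"
      proof (cases "distinct xs")
        case True
        then obtain j where "j < length xs" "x = xs ! j"
          using False by (auto simp: in_set_conv_nth)
        then show ?thesis using f_zero by (intro disjI2 prod_zero bexI[of _ j]) auto
      qed (simp add: Cons)
      then show ?thesis using False energy_Cons by auto
    qed
  qed
qed

text \<open>Every n-element set has n! orderings, which will cancel the 1/n! of the grand canonical
  sum.\<close>

lemma sum_configs_distinct:
  fixes F :: "(int ^ 'd) set \<Rightarrow> real"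
  assumes "finite \<Lambda>"
  shows "(\<Sum>ys\<in>configs \<Lambda> n. if distinct ys then F (set ys) else 0) =
    fact n * (\<Sum>U | U \<subseteq> \<Lambda> \<and> card U = n. F U)"
proof -
  let ?D = "{ys \<in> configs \<Lambda> n. distinct ys}" and ?U = "{U. U \<subseteq> \<Lambda> \<and> card U = n}"
  have fin: "finite (configs \<Lambda> n)"
    unfolding configs_def using finite_lists_length_eq[OF assms, of n] by (simp add: conj_commute)
  then have fin_distinct: "finite ?D" by simp
  have "(\<Sum>ys\<in>configs \<Lambda> n. if distinct ys then F (set ys) else 0) = (\<Sum>ys\<in>?D. F (set ys))"
    using fin by (simp add: sum.inter_filter)
  also have "\<dots> = (\<Sum>U\<in>?U. \<Sum>ys\<in>{ys \<in> ?D. set ys = U}. F (set ys))"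
  proof (rule sum.group[OF fin_distinct, symmetric])
    show "finite ?U" using assms by simp
    show "set ` ?D \<subseteq> ?U" by (auto simp: configs_def distinct_card)
  qed
  also have "\<dots> = (\<Sum>U\<in>?U. fact n * F U)"
  proof (rule sum.cong[OF refl])
    fix U assume U: "U \<in> ?U"
    then have "finite U" using assms by (auto dest: finite_subset)
    moreover have "{ys \<in> ?D. set ys = U} = permutations_of_set U"
      using U by (auto simp: configs_def permutations_of_set_def distinct_card)
    moreover have "(\<Sum>ys\<in>permutations_of_set U. F (set ys)) = (\<Sum>ys\<in>permutations_of_set U. F U)"
      by (intro sum.cong refl arg_cong[where f = F]) (simp add: permutations_of_set_def)
    ultimately show "(\<Sum>ys\<in>{ys \<in> ?D. set ys = U}. F (set ys)) = fact n * F U"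
      using U by simp
  qed
  finally show ?thesis by (simp add: sum_distrib_left)
qed

lemma suminf_configs_distinct:
  fixes F :: "(int ^ 'd) set \<Rightarrow> real"
  assumes "finite \<Lambda>"
  shows "(\<Sum>n. z ^ (m + n) / fact n * (\<Sum>ys\<in>configs \<Lambda> n. if distinct ys then F (set ys) else 0)) =
    (\<Sum>U\<in>Pow \<Lambda>. z ^ (m + card U) * F U)"
proof -
  let ?U = "\<lambda>n. {U \<in> Pow \<Lambda>. card U = n}"
  have "(\<Sum>n. z ^ (m + n) / fact n * (\<Sum>ys\<in>configs \<Lambda> n. if distinct ys then F (set ys) else 0))
      = (\<Sum>n. \<Sum>U\<in>?U n. z ^ (m + card U) * F U)"
    unfolding sum_configs_distinct[OF assms] by (simp add: sum_distrib_left)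
  also have "\<dots> = (\<Sum>n\<le>card \<Lambda>. \<Sum>U\<in>?U n. z ^ (m + card U) * F U)"
  proof (rule suminf_finite)
    fix n assume "n \<notin> {..card \<Lambda>}"
    then have "?U n = {}" using card_mono[OF assms] by fastforce
    then show "(\<Sum>U\<in>?U n. z ^ (m + card U) * F U) = 0" by (simp only: sum.empty)
  qed simp
  also have "\<dots> = (\<Sum>U\<in>Pow \<Lambda>. z ^ (m + card U) * F U)"
    by (rule sum.group) (use assms card_mono[OF assms] in auto)
  finally show ?thesis .
qed

context
  fixes \<Phi> :: "int ^ 'd \<Rightarrow> ereal" and \<Lambda> :: "(int ^ 'd) set"
  assumes not_minf: "\<And>x. \<Phi> x \<noteq> - \<infinity>"
    and even: "even_weight (\<lambda>x. exp_minus (\<Phi> x))"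
    and fin: "finite \<Lambda>"
begin

lemma configs_sum_eq_gibbs_sum:
  assumes "set xs \<subseteq> \<Lambda>" "distinct xs"
  shows "(\<Sum>n. z ^ (length xs + n) / fact n * (\<Sum>ys\<in>configs \<Lambda> n. exp_minus (energy \<Phi> (xs @ ys)))) =
    gibbs_sum \<Lambda> (\<lambda>_. z) (\<lambda>x. exp_minus (\<Phi> x)) (set xs)"
proof -
  let ?f = "\<lambda>x. exp_minus (\<Phi> x)" and ?X = "set xs"
  \<comment> \<open>Sets meeting the prescribed points get weight 0, since the joint list then
    repeats a point.\<close>
  let ?F = "\<lambda>U. if U \<inter> ?X = {} then pair_weight ?f (?X \<union> U) else 0"
  have "exp_minus (energy \<Phi> (xs @ ys)) = (if distinct ys then ?F (set ys) else 0)" for ys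
    unfolding exp_minus_energy[OF not_minf even] using assms(2) by auto
  then have "(\<Sum>n. z ^ (length xs + n) / fact n * (\<Sum>ys\<in>configs \<Lambda> n. exp_minus (energy \<Phi> (xs @ ys))))
      = (\<Sum>U\<in>Pow \<Lambda>. z ^ (length xs + card U) * ?F U)"
    using suminf_configs_distinct[OF fin, of z "length xs" ?F] by simp
  also have "\<dots> = (\<Sum>U\<in>Pow (\<Lambda> - ?X). z ^ (length xs + card U) * pair_weight ?f (?X \<union> U))"
    by (rule sum.mono_neutral_cong_right) (use fin in auto)
  also have "\<dots> = (\<Sum>U\<in>Pow (\<Lambda> - ?X). activity_weight (\<lambda>_. z) ?f (?X \<union> U))"
  proof (rule sum.cong[OF refl])
    fix U assume "U \<in> Pow (\<Lambda> - ?X)"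
    then have "card (?X \<union> U) = length xs + card U"
      using fin distinct_card[OF assms(2)] by (subst card_Un_disjoint) (auto dest: finite_subset)
    then show "z ^ (length xs + card U) * pair_weight ?f (?X \<union> U)
        = activity_weight (\<lambda>_. z) ?f (?X \<union> U)"
      by (simp add: activity_weight_def)
  qed
  also have "\<dots> = gibbs_sum \<Lambda> (\<lambda>_. z) ?f ?X"
    unfolding gibbs_sum_def
    by (rule sum.reindex_bij_betw, rule bij_betw_byWitness[where f' = "\<lambda>V. V - ?X"])
      (use assms(1) in auto)
  finally show ?thesis .
qed

lemma partition_function_eq_gibbs_sum:
  "partition_function \<Lambda> z \<Phi> = gibbs_sum \<Lambda> (\<lambda>_. z) (\<lambda>x. exp_minus (\<Phi> x)) {}"
  using configs_sum_eq_gibbs_sum[of "[]" z] by (simp add: partition_function_def)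

lemma correlation_eq_gibbs_sum:
  assumes "set xs \<subseteq> \<Lambda>" "distinct xs"
  shows "correlation \<Lambda> z \<Phi> xs = gibbs_sum \<Lambda> (\<lambda>_. z) (\<lambda>x. exp_minus (\<Phi> x)) (set xs) /
    gibbs_sum \<Lambda> (\<lambda>_. z) (\<lambda>x. exp_minus (\<Phi> x)) {}"
  unfolding correlation_def configs_sum_eq_gibbs_sum[OF assms] partition_function_eq_gibbs_sum
  by (simp add: field_simps)

lemma correlation_not_distinct: "\<not> distinct xs \<Longrightarrow> correlation \<Lambda> z \<Phi> xs = 0"
  unfolding correlation_def exp_minus_energy[OF not_minf even] by simp

end

section \<open>Boxes, the potential and the assembly\<close>

lemma finite_lattice_box: "finite (lattice_box k :: (int ^ 'd) set)"
proof -
  have "($) ` (lattice_box k :: (int ^ 'd) set) \<subseteq> UNIV \<rightarrow>\<^sub>E {- int k..int k}"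
    by (auto simp: lattice_box_def abs_le_iff minus_le_iff)
  then have "finite (($) ` (lattice_box k :: (int ^ 'd) set))"
    by (rule finite_subset) (intro finite_PiE; simp)
  then show ?thesis
    by (rule finite_imageD) (simp add: inj_on_def vec_eq_iff fun_eq_iff)
qed

lemma eventually_subset_lattice_box:
  fixes S :: "(int ^ 'd) set"
  assumes "finite S"
  shows "\<forall>\<^sub>F k in sequentially. S \<subseteq> lattice_box k"
proof -
  have "\<forall>\<^sub>F k in sequentially. \<forall>x\<in>S. \<forall>i\<in>UNIV. \<bar>x $ i\<bar> \<le> int k"
  proof (intro eventually_ball_finite ballI assms finite)
    fix x :: "int ^ 'd" and i
    show "\<forall>\<^sub>F k in sequentially. \<bar>x $ i\<bar> \<le> int k"
      by (rule eventually_sequentiallyI[of "nat \<bar>x $ i\<bar>"]) simp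
  qed
  then show ?thesis by (auto simp: lattice_box_def elim!: eventually_mono)
qed

text \<open>Inverts the passage from a potential to its Mayer function; where g = -1 the logarithm
  has no meaningful value and the potential is a hard core.\<close>

definition mayer_potential :: "('a \<Rightarrow> real) \<Rightarrow> 'a \<Rightarrow> ereal" where
  "mayer_potential g x = (if g x = - 1 then \<infinity> else ereal (- ln (1 + g x)))"

lemma exp_minus_mayer_potential: "0 \<le> 1 + g x \<Longrightarrow> exp_minus (mayer_potential g x) = 1 + g x"
  by (auto simp: mayer_potential_def exp_minus_def)

theorem theorem2p2:
  fixes r :: real
  assumes "0 < r" and "r < 1"
  shows "\<exists>\<epsilon>>0. \<forall>(\<rho>1::real) (\<rho>2 :: int ^ 'd \<Rightarrow> real).
    0 < \<rho>1 \<and> \<rho>1 \<le> \<epsilon> \<and>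
    \<rho>2 0 = 0 \<and> (\<forall>x. \<rho>2 (- x) = \<rho>2 x) \<and>
    (\<lambda>x. \<bar>\<rho>2 x - \<rho>1\<^sup>2\<bar>) summable_on (- {0}) \<and>
    (\<Sum>\<^sub>\<infinity>x\<in>- {0}. \<bar>\<rho>2 x - \<rho>1\<^sup>2\<bar>) \<le> r * \<rho>1\<^sup>2
    \<longrightarrow>
    (\<exists>(\<Phi> :: int ^ 'd \<Rightarrow> ereal) (z::real).
       pair_potential \<Phi> \<and> z > 0 \<and>
       (\<exists>a<1. \<forall>x. x \<noteq> 0 \<longrightarrow> mayer \<Phi> x \<ge> - a) \<and>
       mayer \<Phi> 0 = - 1 \<and> (\<forall>x. mayer \<Phi> x = mayer \<Phi> (- x)) \<and>
       (\<lambda>x. \<bar>mayer \<Phi> x\<bar>) summable_on (- {0}) \<and>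
       (\<exists>c. (\<Sum>\<^sub>\<infinity>x\<in>- {0}. \<bar>mayer \<Phi> x\<bar>) \<le> c) \<and>
       (\<forall>x1. has_inf_vol_correlation z \<Phi> [x1] \<rho>1) \<and>
       (\<forall>x1 x2. has_inf_vol_correlation z \<Phi> [x1, x2] (\<rho>2 (x2 - x1))))"
proof -
  \<comment> \<open>Both constants meet the requirements of \<open>inverse_problem\<close> with
    equality.\<close>
  define \<xi> :: real where "\<xi> = 64 * exp 6"
  define \<delta> where "\<delta> = (1 - r) / 144"
  have \<xi>: "0 < \<xi>" and \<delta>: "0 < \<delta>" using assms by (auto simp: \<xi>_def \<delta>_def)
  \<comment> \<open>The largest density with exp (3 \<xi> \<epsilon>) - 1 \<le> \<delta>; it depends
    on \<open>r\<close> alone.\<close>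
  define \<epsilon> where "\<epsilon> = ln (1 + \<delta>) / (\<xi> * 3)"
  have \<epsilon>: "0 < \<epsilon>" using \<xi> \<delta> by (simp add: \<epsilon>_def)
  show ?thesis
  proof (rule exI[of _ \<epsilon>], intro conjI allI impI, rule \<epsilon>)
    fix \<rho> :: real and \<rho>2 :: "int ^ 'd \<Rightarrow> real"
    assume "0 < \<rho> \<and> \<rho> \<le> \<epsilon> \<and> \<rho>2 0 = 0 \<and> (\<forall>x. \<rho>2 (- x) = \<rho>2 x) \<and>
      (\<lambda>x. \<bar>\<rho>2 x - \<rho>\<^sup>2\<bar>) summable_on (- {0}) \<and>
      (\<Sum>\<^sub>\<infinity>x\<in>- {0}. \<bar>\<rho>2 x - \<rho>\<^sup>2\<bar>) \<le> r * \<rho>\<^sup>2"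
    then have \<rho>: "0 < \<rho>" "\<rho> \<le> \<epsilon>" and \<rho>2: "\<rho>2 0 = 0" "\<And>x. \<rho>2 (- x) = \<rho>2 x"
      and summ: "(\<lambda>x. \<bar>\<rho>2 x - \<rho>\<^sup>2\<bar>) summable_on (- {0})"
      and le: "(\<Sum>\<^sub>\<infinity>x\<in>- {0}. \<bar>\<rho>2 x - \<rho>\<^sup>2\<bar>) \<le> r * \<rho>\<^sup>2"
      by auto
    define h where "h x = \<rho>2 x / \<rho>\<^sup>2 - 1" for x
    have h0: "h 0 = - 1" using \<rho>2 by (simp add: h_def)
    have h_sum': "(\<Sum>x\<in>F. \<bar>h x\<bar>) \<le> r" if "finite F" "0 \<notin> F" for F
    proof -
      have "(\<Sum>x\<in>F. \<bar>\<rho>2 x - \<rho>\<^sup>2\<bar>) \<le> r * \<rho>\<^sup>2"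
        by (rule order_trans[OF finite_sum_le_infsum[OF summ] le]) (use that in auto)
      moreover have "\<bar>h x\<bar> = \<bar>\<rho>2 x - \<rho>\<^sup>2\<bar> / \<rho>\<^sup>2" for x
      proof -
        have "h x = (\<rho>2 x - \<rho>\<^sup>2) / \<rho>\<^sup>2" using \<rho> by (simp add: h_def diff_divide_distrib)
        then show ?thesis by simp
      qed
      ultimately show ?thesis using \<rho> by (simp add: sum_divide_distrib[symmetric] divide_le_eq)
    qed
    interpret inverse_problem h r \<rho> \<xi> \<delta>
    proof
      have "\<xi> * (3 * \<rho>) \<le> ln (1 + \<delta>)" using \<rho>(2) \<xi> by (simp add: \<epsilon>_def field_simps)
      then show "exp (\<xi> * (3 * \<rho>)) - 1 \<le> \<delta>" using \<delta> by (simp add: ln_ge_iff)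
      show "h (- x) = h x" for x by (simp add: h_def \<rho>2)
      \<comment> \<open>The origin contributes |h 0| = 1, all other points together at most
        \<open>r\<close>.\<close>
      show "(\<Sum>x\<in>F. \<bar>h x\<bar>) \<le> 1 + r" if "finite F" for F
        using h_sum'[of F] h_sum'[of "F - {0}"] that h0
        by (cases "0 \<in> F") (auto simp: sum.remove)
    qed (use assms \<rho> in \<open>auto simp: \<xi>_def \<delta>_def\<close>)
    obtain \<sigma> g where fixed: "admissible \<sigma> g" "\<And>i S. finite S \<Longrightarrow> ks_corr \<rho> g \<sigma> i S = \<sigma> i S"
      "\<And>x. ks_mayer h \<rho> g \<sigma> x = g x"
      using ks_fixed_point by metis
    define z where "z = \<rho> / ks_sum \<rho> g (\<sigma> None) 0 {}"
    interpret inverse_solution h r \<rho> \<xi> \<delta> \<sigma> g z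
    proof
      show "- r \<le> h x" if "x \<noteq> 0" for x using h_sum'[of "{x}"] that by auto
    qed (use fixed h0 z_def in auto)
    define \<Phi> where "\<Phi> = mayer_potential g"
    have exp_\<Phi>: "(\<lambda>x. exp_minus (\<Phi> x)) = (\<lambda>x. 1 + g x)"
      unfolding \<Phi>_def using f_nonneg by (intro ext exp_minus_mayer_potential)
    have mayer: "mayer \<Phi> = g"
      using fun_cong[OF exp_\<Phi>] by (auto simp: mayer_def)
    have even: "even_weight (\<lambda>x. exp_minus (\<Phi> x))"
      unfolding exp_\<Phi> by (rule even_weight_axioms)
    have g_even: "g (- x) = g x" for x using admissibleD(5)[OF fixed(1)] .
    \<comment> \<open>The l^1 bound 3 on \<open>g\<close> gives 1 + g \<le> 4 pointwise.\<close>
    have lower: "ereal (- ln 4) \<le> \<Phi> x" for x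
    proof (cases "g x = - 1")
      case False
      then have "0 < 1 + g x" using f_nonneg[of x] by simp
      then have "ln (1 + g x) \<le> ln 4" using mayer_bound[of x] by simp
      then show ?thesis using False by (simp add: \<Phi>_def mayer_potential_def)
    qed (simp add: \<Phi>_def mayer_potential_def)
    then have not_minf: "\<Phi> x \<noteq> - \<infinity>" for x by (metis MInfty_neq_ereal(1) ereal_infty_less_eq(2))
    have g_sum: "(\<Sum>x\<in>F. \<bar>g x\<bar>) \<le> 3" if "finite F" for F
      using mayer_sum[OF that] by simp
    have g_summ: "(\<lambda>x. \<bar>g x\<bar>) summable_on (- {0})"
      using g_sum by (intro nonneg_bdd_above_summable_on bdd_aboveI[of _ 3]) auto
    have act: "activity None = (\<lambda>_. z)" by (simp add: palm_weight_def)
    note box = box_corr_tendsto[OF finite_lattice_box eventually_subset_lattice_box]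
    have N_pos: "0 < gibbs_sum (lattice_box k) (activity i) (\<lambda>x. 1 + g x) {}" for k i
      by (rule gibbs_sum_empty_pos[OF finite_lattice_box activity_nonneg])
    have in_box: "\<forall>\<^sub>F k in sequentially. set xs \<subseteq> lattice_box k" for xs :: "(int ^ 'd) list"
      by (rule eventually_subset_lattice_box) simp
    have one: "has_inf_vol_correlation z \<Phi> [x] \<rho>" for x
    proof -
      have "(\<lambda>k. \<rho> * box_corr (lattice_box k) None {x}) \<longlonglongrightarrow> \<rho> * \<sigma> None {x}"
        by (intro tendsto_intros box) simp_all
      moreover have "\<forall>\<^sub>F k in sequentially.
          \<rho> * box_corr (lattice_box k) None {x} = correlation (lattice_box k) z \<Phi> [x]"
        using in_box[of "[x]"]
      proof eventually_elim
        case (elim k)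
        then show ?case
          using correlation_eq_gibbs_sum[OF not_minf even finite_lattice_box elim, of z] \<rho>
          by (simp add: box_corr_def exp_\<Phi> act)
      qed
      ultimately show ?thesis
        unfolding has_inf_vol_correlation_def by (simp add: corr_singleton Lim_transform_eventually)
    qed
    have two: "has_inf_vol_correlation z \<Phi> [x, y] (\<rho>2 (y - x))" for x y
    proof (cases "x = y")
      \<comment> \<open>By the hard core the correlation is 0 in every box, in agreement with the
        prescribed value 0 at the origin.\<close>
      case True
      then show ?thesis
        unfolding has_inf_vol_correlation_def
        by (simp add: correlation_not_distinct[OF not_minf even finite_lattice_box] \<rho>2)
    next
      case False
      \<comment> \<open>The chain rule in the box: the two-point function is the density at
        \<open>x\<close> times the density at \<open>y\<close> of the system conditioned on
        \<open>x\<close>. Its limit thus comes from two one-point limits.\<close>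
      have "(\<lambda>k. \<rho> * box_corr (lattice_box k) None {x} * (\<rho> * box_corr (lattice_box k) (Some x) {y}))
          \<longlonglongrightarrow> \<rho> * \<sigma> None {x} * (\<rho> * \<sigma> (Some x) {y})"
        by (intro tendsto_intros box) simp_all
      moreover have "\<rho> * \<sigma> None {x} * (\<rho> * \<sigma> (Some x) {y}) = \<rho>2 (y - x)"
        using \<rho> by (simp add: corr_singleton corr_palm_singleton h_def power2_eq_square)
      moreover have "\<forall>\<^sub>F k in sequentially.
          \<rho> * box_corr (lattice_box k) None {x} * (\<rho> * box_corr (lattice_box k) (Some x) {y})
            = correlation (lattice_box k) z \<Phi> [x, y]"
        using in_box[of "[x, y]"]
      proof eventually_elim
        case (elim k)
        let ?N = "\<lambda>i. gibbs_sum (lattice_box k) (activity i) (\<lambda>x. 1 + g x)"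
        have some: "activity (Some x) = (\<lambda>u. z * (1 + g (u - x)))" by (simp add: palm_weight_def)
        have "?N None {x, y} = z * ?N (Some x) {y}" "?N None {x} = z * ?N (Some x) {}"
          unfolding act some using elim False
          by (auto intro!: gibbs_sum_palm[OF finite_lattice_box])
        moreover have "correlation (lattice_box k) z \<Phi> [x, y] = ?N None {x, y} / ?N None {}"
          using correlation_eq_gibbs_sum[OF not_minf even finite_lattice_box elim, of z] False
          by (simp add: exp_\<Phi> act)
        ultimately show ?case
          using N_pos[of k "Some x"] N_pos[of k None] \<rho> by (simp add: box_corr_def)
      qed
      ultimately show ?thesis
        unfolding has_inf_vol_correlation_def by (simp add: Lim_transform_eventually)
    qed
    have "pair_potential \<Phi>"
      unfolding pair_potential_def
    proof (intro conjI allI exI[of _ "- ln 4"] lower)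
      show "\<Phi> (- x) = \<Phi> x" for x by (simp add: \<Phi>_def mayer_potential_def g_even)
      show "\<Phi> 0 = \<infinity>" by (simp add: \<Phi>_def mayer_potential_def mayer_zero)
    qed
    moreover have "\<exists>a<1. \<forall>x. x \<noteq> 0 \<longrightarrow> - a \<le> g x"
      using mayer_ge assms by (intro exI[of _ "(1 + r) / 2"]) auto
    ultimately show "\<exists>(\<Phi> :: int ^ 'd \<Rightarrow> ereal) (z::real).
       pair_potential \<Phi> \<and> z > 0 \<and>
       (\<exists>a<1. \<forall>x. x \<noteq> 0 \<longrightarrow> mayer \<Phi> x \<ge> - a) \<and>
       mayer \<Phi> 0 = - 1 \<and> (\<forall>x. mayer \<Phi> x = mayer \<Phi> (- x)) \<and>
       (\<lambda>x. \<bar>mayer \<Phi> x\<bar>) summable_on (- {0}) \<and>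
       (\<exists>c. (\<Sum>\<^sub>\<infinity>x\<in>- {0}. \<bar>mayer \<Phi> x\<bar>) \<le> c) \<and>
       (\<forall>x1. has_inf_vol_correlation z \<Phi> [x1] \<rho>) \<and>
       (\<forall>x1 x2. has_inf_vol_correlation z \<Phi> [x1, x2] (\<rho>2 (x2 - x1)))"
      using z_pos mayer_zero g_even g_summ one two
      by (intro exI[of _ \<Phi>] exI[of _ z]) (auto simp: mayer)
  qed
qed

end
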